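(* Let $A[1..n]$ be an array whose entries form a permutation of $\{1,\dots,n\}$, and let $\rho$ be the number of runs of $A$. In the word RAM model with word size $w=\Omega(\lg n)$, there is a data structure built from $A$ that occupies $2\rho\lg n+o(n)$ bits and that answers any range minimum query $\mathrm{RMQ}_A(i,j)$, $1\le i\le j\le n$, with zero accesses to $A$ and $O(1)$ operations on the data structure (a non-systematic compressed succinct index).
   Context: $\mathrm{RMQ}_A(i,j)$ denotes the position of the minimum of $A[i..j]$. A run of $A$ is a maximal block of consecutive positions on which $A$ is increasing; the number of runs is $\rho=1+|\{t : 1\le t<n,\ A[t+1]<A[t]\}|$. *)

theory Defs
  imports Complex_Main "HOL-Library.Landau_Symbols"
begin

text \<open>
  Arrays \<open>A[1..n]\<close> are functions whose values outside \<open>{1..n}\<close> are irrelevant.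
\<close>

definition rmq :: "(nat \<Rightarrow> nat) \<Rightarrow> nat \<Rightarrow> nat \<Rightarrow> nat" where
  "rmq A i j = arg_min_on A {i..j}"

definition runs :: "nat \<Rightarrow> (nat \<Rightarrow> nat) \<Rightarrow> nat" where
  "runs n A = 1 + card {t. 1 \<le> t \<and> t < n \<and> A (t + 1) < A t}"

text \<open>
  The word RAM with word size \<open>w\<close>.  A word is a natural number below \<open>2 ^ w\<close>; every register and
  every memory cell holds one word, and every instruction takes one time unit.  The data structure
  is a bit string in a read-only memory: its \<open>a\<close>-th word consists of the bits \<open>a * w, \<dots>, a * w + w - 1\<close>,
  least significant first, and positions past the end of the bit string read as zero.  Apart
  from it, a program only has its registers and a scratch memory, both zero initially except for
  the registers holding the arguments.  In particular, no instruction gives access to the array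
  from which the data structure was built.
\<close>

datatype binop = Add | Sub | Mul | Div | Mod | BAnd | BOr | BXor | Shl | Shr | Eq | Less

unbundle bit_operations_syntax

text \<open>Arithmetic is modulo \<open>2 ^ w\<close>; comparisons yield \<open>1\<close> or \<open>0\<close>.\<close>

fun binop_val :: "nat \<Rightarrow> binop \<Rightarrow> nat \<Rightarrow> nat \<Rightarrow> nat" where
  "binop_val w Add x y = take_bit w (x + y)"
| "binop_val w Sub x y = take_bit w (x + 2 ^ w - y)"
| "binop_val w Mul x y = take_bit w (x * y)"
| "binop_val w Div x y = x div y"
| "binop_val w Mod x y = x mod y"
| "binop_val w BAnd x y = x AND y"
| "binop_val w BOr x y = x OR y"
| "binop_val w BXor x y = x XOR y"
| "binop_val w Shl x y = take_bit w (push_bit y x)"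
| "binop_val w Shr x y = drop_bit y x"
| "binop_val w Eq x y = of_bool (x = y)"
| "binop_val w Less x y = of_bool (x < y)"

unbundle no bit_operations_syntax

type_synonym reg = nat

text \<open>
  \<open>Const r k\<close> loads the constant \<open>k\<close>, \<open>Word_Size r\<close> the word size, \<open>Probe r a\<close> the word of the data
  structure whose address is in register \<open>a\<close>; \<open>Load r a\<close> and \<open>Store a r\<close> access the scratch memory at
  the address in register \<open>a\<close>; \<open>Jump_Zero r k\<close> continues with instruction number \<open>k\<close> if register
  \<open>r\<close> is zero.  The machine halts when the program counter leaves the program.
\<close>

datatype instr =
    Const reg nat
  | Word_Size reg
  | Op binop reg reg reg
  | Probe reg reg
  | Load reg reg
  | Store reg reg
  | Jump nat
  | Jump_Zero reg nat

record config =
  pc :: nat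
  regs :: "reg \<Rightarrow> nat"
  mem :: "nat \<Rightarrow> nat"

definition word_at :: "nat \<Rightarrow> bool list \<Rightarrow> nat \<Rightarrow> nat" where
  "word_at w D a = horner_sum of_bool 2 (take w (drop (a * w) D))"

definition set_reg :: "reg \<Rightarrow> nat \<Rightarrow> config \<Rightarrow> config" where
  "set_reg r x s = s\<lparr>pc := pc s + 1, regs := (regs s)(r := x)\<rparr>"

fun exec_instr :: "nat \<Rightarrow> bool list \<Rightarrow> instr \<Rightarrow> config \<Rightarrow> config" where
  "exec_instr w D (Const r k) s = set_reg r (take_bit w k) s"
| "exec_instr w D (Word_Size r) s = set_reg r w s"
| "exec_instr w D (Op f r a b) s = set_reg r (binop_val w f (regs s a) (regs s b)) s"
| "exec_instr w D (Probe r a) s = set_reg r (word_at w D (regs s a)) s"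
| "exec_instr w D (Load r a) s = set_reg r (mem s (regs s a)) s"
| "exec_instr w D (Store a r) s = s\<lparr>pc := pc s + 1, mem := (mem s)(regs s a := regs s r)\<rparr>"
| "exec_instr w D (Jump k) s = s\<lparr>pc := k\<rparr>"
| "exec_instr w D (Jump_Zero r k) s = s\<lparr>pc := (if regs s r = 0 then k else pc s + 1)\<rparr>"

definition halted :: "instr list \<Rightarrow> config \<Rightarrow> bool" where
  "halted P s \<longleftrightarrow> length P \<le> pc s"

definition step :: "nat \<Rightarrow> bool list \<Rightarrow> instr list \<Rightarrow> config \<Rightarrow> config" where
  "step w D P s = (if halted P s then s else exec_instr w D (P ! pc s) s)"

definition init :: "nat \<Rightarrow> nat \<Rightarrow> config" where
  "init i j = \<lparr>pc = 0, regs = (\<lambda>_. 0)(0 := i, 1 := j), mem = (\<lambda>_. 0)\<rparr>"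

text \<open>
  On the arguments \<open>i\<close> and \<open>j\<close>, the program \<open>P\<close> halts after at most \<open>T\<close> instructions with result \<open>x\<close>,
  which it leaves in register \<open>0\<close>.
\<close>

definition answers :: "nat \<Rightarrow> bool list \<Rightarrow> instr list \<Rightarrow> nat \<Rightarrow> nat \<Rightarrow> nat \<Rightarrow> nat \<Rightarrow> bool" where
  "answers w D P T i j x \<longleftrightarrow>
     (\<exists>t\<le>T. let s = (step w D P ^^ t) (init i j) in halted P s \<and> regs s 0 = x)"

end

theory Submission
  imports Defs "HOL-Library.Discrete_Functions" "HOL-Real_Asymp.Real_Asymp"
begin

text \<open>
  Within a run the minimum is the head of the run.  Hence a range minimum of \<open>A\<close> is either the left
  end \<open>i\<close> of the range or the smallest head \<open>h\<close> strictly between the runs of the two ends, and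
  \<open>A i < A h\<close> holds iff the nearest position left of \<open>h\<close> with a smaller value is at least \<open>i\<close>.  The
  heads and these positions take \<open>2 \<rho> lg n\<close> bits.  It remains to find the run of a position and range
  minima over the heads.

  Range minima are found without the array from depths in the tree of nearest smaller values to the
  left: of the minimum positions of two overlapping or adjacent ranges, the shallower one is the
  minimum of the union.  Depths grow by at most one per step, so they are stored relative to their
  block except in a few blocks.  Sparse tables inside and across blocks of length \<open>L ^ 2\<close>, with
  \<open>L\<close> about \<open>lg n\<close>, then answer queries on \<open>N\<close> elements with \<open>O(N (lg L) ^ 2)\<close> bits.  On the heads
  this is \<open>o(n)\<close> if \<open>\<rho>\<close> is at most of order \<open>n (lg L) ^ 2 / L\<close>; for more runs, the same index on
  the whole array fits into \<open>2 \<rho> lg n + o(n)\<close> bits.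

  For bounded word sizes the array itself is stored and scanned.
\<close>

section \<open>Expressions and their compilation\<close>

unbundle bit_operations_syntax

text \<open>One program has to serve all \<open>n\<close> and \<open>w\<close> and receives only
  \<open>i\<close> and \<open>j\<close>, so every parameter that depends on \<open>n\<close> is read
  from the bit string. As \<open>w\<close> may be far larger than \<open>lg n\<close>, cells of
  \<open>w\<close> bits would break the space bound; the structure therefore has its own word length
  \<open>L\<close>, with \<open>L - 1 = floor_log n\<close> for large \<open>n\<close>, and reads
  are unaligned. The other parameters balance costs. All small fields have \<open>s\<close> bits,
  where \<open>s\<close> is about \<open>3 * lg L\<close>. With blocks of length
  \<open>L ^ 2\<close>, a record of about \<open>L\<close> words per block costs \<open>O(N)\<close>
  bits. The explicit depths of a block cost \<open>L ^ 3 \<le> 2 ^ s\<close> bits, which is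
  affordable because at most \<open>N / 2 ^ s\<close> blocks have depth range \<open>2 ^ s\<close>
  or more; in all other blocks a relative depth fits into a field. The number of the current run is
  stored for every \<open>s ^ 2\<close>-th position, relative to a sparser sample, which takes about
  \<open>n / s\<close> bits; finer tables exist only per run.\<close>

datatype exp = Cst nat | WSize | ArgI | ArgJ | Bin binop exp exp | Prb exp | Ite exp exp exp

fun ev :: "nat \<Rightarrow> bool list \<Rightarrow> nat \<Rightarrow> nat \<Rightarrow> exp \<Rightarrow> nat" where
  "ev w D i j (Cst k) = take_bit w k"
| "ev w D i j WSize = w"
| "ev w D i j ArgI = i"
| "ev w D i j ArgJ = j"
| "ev w D i j (Bin f a b) = binop_val w f (ev w D i j a) (ev w D i j b)"
| "ev w D i j (Prb a) = word_at w D (ev w D i j a)"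
| "ev w D i j (Ite c a b) = (if ev w D i j c = 0 then ev w D i j b else ev w D i j a)"

text \<open>
  The code of an expression, to be placed at position \<open>p\<close> of the program; it leaves the value in
  register \<open>r\<close> and modifies no register below \<open>r\<close>.  Registers \<open>0\<close> and \<open>1\<close> keep the arguments.
\<close>

fun compile :: "exp \<Rightarrow> reg \<Rightarrow> nat \<Rightarrow> instr list" where
  "compile (Cst k) r p = [Const r k]"
| "compile WSize r p = [Word_Size r]"
| "compile ArgI r p = [Op BOr r 0 0]"
| "compile ArgJ r p = [Op BOr r 1 1]"
| "compile (Bin f a b) r p =
     (let ca = compile a r p in ca @ compile b (Suc r) (p + length ca) @ [Op f r r (Suc r)])"
| "compile (Prb a) r p = compile a r p @ [Probe r r]"
| "compile (Ite c a b) r p =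
     (let cc = compile c r p;
          ca = compile a r (p + length cc + 1);
          q = p + length cc + length ca + 2;
          cb = compile b r q
      in cc @ [Jump_Zero r q] @ ca @ [Jump (q + length cb)] @ cb)"

definition runs_code :: "nat \<Rightarrow> bool list \<Rightarrow> instr list \<Rightarrow> nat \<Rightarrow> reg \<Rightarrow> nat \<Rightarrow> config \<Rightarrow> nat \<Rightarrow> bool" where
  "runs_code w D P l r x s p \<longleftrightarrow>
     (\<exists>t\<le>l. let s' = (step w D P ^^ t) s in
        pc s' = p \<and> regs s' r = x \<and> (\<forall>y<r. regs s' y = regs s y))"

lemma step_at:
  assumes "P = pre @ c # post" "pc s = length pre"
  shows "step w D P s = exec_instr w D c s"
  using assms by (simp add: step_def halted_def)

lemma runs_code_single:
  assumes "P = pre @ c # post" "pc s = length pre"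
    and "exec_instr w D c s = set_reg r x s"
  shows "runs_code w D P 1 r x s (Suc (length pre))"
  unfolding runs_code_def Let_def
  by (rule exI[of _ 1]) (use assms(2,3) in \<open>simp add: step_at[OF assms(1,2)] set_reg_def\<close>)

text \<open>All jumps go forward, so every instruction is executed at most once and the code length
  bounds the time. Jump targets are absolute, hence the claim for an arbitrary context
  \<open>pre\<close>, \<open>post\<close>; \<open>2 \<le> r\<close> protects the arguments.\<close>

lemma compile_runs:
  assumes "P = pre @ compile e r (length pre) @ post" "pc s = length pre"
    and "2 \<le> r" "regs s 0 = i" "regs s 1 = j"
  shows "runs_code w D P (length (compile e r (length pre))) r (ev w D i j e) s
           (length pre + length (compile e r (length pre)))"
  using assms
proof (induction e arbitrary: r pre post s)
  case (Cst k)
  then show ?case using runs_code_single[of P pre "Const r k" post s] by simp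
next
  case WSize
  then show ?case using runs_code_single[of P pre "Word_Size r" post s] by simp
next
  case ArgI
  then show ?case using runs_code_single[of P pre "Op BOr r 0 0" post s] by simp
next
  case ArgJ
  then show ?case using runs_code_single[of P pre "Op BOr r 1 1" post s] by simp
next
  case (Bin f a b)
  define ca where "ca = compile a r (length pre)"
  define cb where "cb = compile b (Suc r) (length pre + length ca)"
  have P: "P = pre @ ca @ cb @ Op f r r (Suc r) # post"
    using Bin.prems(1) by (simp add: ca_def cb_def Let_def)
  obtain t1 s1 where t1: "t1 \<le> length ca" "s1 = (step w D P ^^ t1) s"
    "pc s1 = length pre + length ca" "regs s1 r = ev w D i j a" "\<forall>y<r. regs s1 y = regs s y"
    using Bin.IH(1)[of pre r "cb @ Op f r r (Suc r) # post" s] Bin.prems(2-5) P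
    by (auto simp: runs_code_def Let_def ca_def)
  obtain t2 s2 where t2: "t2 \<le> length cb" "s2 = (step w D P ^^ t2) s1"
    "pc s2 = length pre + length ca + length cb" "regs s2 (Suc r) = ev w D i j b"
    "\<forall>y<Suc r. regs s2 y = regs s1 y"
    using Bin.IH(2)[of "pre @ ca" "Suc r" "Op f r r (Suc r) # post" s1] Bin.prems(2-5) P t1(3-5)
    by (auto simp: runs_code_def Let_def cb_def)
  have st: "step w D P s2 = set_reg r (ev w D i j (Bin f a b)) s2"
    using step_at[of P "pre @ ca @ cb" "Op f r r (Suc r)" post s2 w D] P t2 t1 by simp
  have "(step w D P ^^ (Suc (t2 + t1))) s = set_reg r (ev w D i j (Bin f a b)) s2"
    using st t1(2) t2(2) by (simp add: funpow_add)
  then show ?case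
    using t1 t2 by (auto simp: runs_code_def Let_def ca_def[symmetric] cb_def[symmetric] set_reg_def
        intro!: exI[of _ "Suc (t2 + t1)"])
next
  case (Prb a)
  define ca where "ca = compile a r (length pre)"
  have P: "P = pre @ ca @ Probe r r # post"
    using Prb.prems(1) by (simp add: ca_def)
  obtain t1 s1 where t1: "t1 \<le> length ca" "s1 = (step w D P ^^ t1) s"
    "pc s1 = length pre + length ca" "regs s1 r = ev w D i j a" "\<forall>y<r. regs s1 y = regs s y"
    using Prb.IH(1)[of pre r "Probe r r # post" s] Prb.prems(2-5) P
    by (auto simp: runs_code_def Let_def ca_def)
  have st: "step w D P s1 = set_reg r (ev w D i j (Prb a)) s1"
    using step_at[of P "pre @ ca" "Probe r r" post s1 w D] P t1 by simp
  have "(step w D P ^^ (Suc t1)) s = set_reg r (ev w D i j (Prb a)) s1"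
    using st t1(2) by simp
  then show ?case
    using t1 by (auto simp: runs_code_def Let_def ca_def[symmetric] set_reg_def
        simp del: funpow.simps intro!: exI[of _ "Suc t1"])
next
  case (Ite c a b)
  define cc where "cc = compile c r (length pre)"
  define ca where "ca = compile a r (length pre + length cc + 1)"
  define q where "q = length pre + length cc + length ca + 2"
  define cb where "cb = compile b r q"
  have code: "compile (Ite c a b) r (length pre) =
      cc @ [Jump_Zero r q] @ ca @ [Jump (q + length cb)] @ cb"
    by (simp add: cc_def ca_def q_def cb_def Let_def)
  have P: "P = pre @ cc @ Jump_Zero r q # ca @ Jump (q + length cb) # cb @ post"
    using Ite.prems(1) unfolding code by simp
  obtain t1 s1 where t1: "t1 \<le> length cc" "s1 = (step w D P ^^ t1) s"
    "pc s1 = length pre + length cc" "regs s1 r = ev w D i j c" "\<forall>y<r. regs s1 y = regs s y"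
    using Ite.IH(1)[of pre r "Jump_Zero r q # ca @ Jump (q + length cb) # cb @ post" s] Ite.prems(2-5) P
    by (auto simp: runs_code_def Let_def cc_def)
  define s2 where "s2 = step w D P s1"
  have s2: "s2 = s1\<lparr>pc := (if ev w D i j c = 0 then q else pc s1 + 1)\<rparr>"
    using step_at[of P "pre @ cc" "Jump_Zero r q" _ s1 w D] P t1 by (simp add: s2_def)
  show ?case
  proof (cases "ev w D i j c = 0")
    case True
    define pre3 where "pre3 = pre @ cc @ Jump_Zero r q # ca @ [Jump (q + length cb)]"
    have len3: "length pre3 = q"
      by (simp add: pre3_def q_def)
    have "P = pre3 @ compile b r (length pre3) @ post"
      unfolding len3 cb_def[symmetric] by (simp add: P pre3_def)
    moreover have "pc s2 = length pre3" "regs s2 0 = i" "regs s2 1 = j"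
      using Ite.prems(3-5) t1(5) s2 True len3 by auto
    ultimately have "runs_code w D P (length cb) r (ev w D i j b) s2 (q + length cb)"
      using Ite.IH(3)[of pre3 r post s2] Ite.prems(3) unfolding len3 cb_def[symmetric] by blast
    then obtain t3 s3 where t3: "t3 \<le> length cb" "s3 = (step w D P ^^ t3) s2"
      "pc s3 = q + length cb" "regs s3 r = ev w D i j b" "\<forall>y<r. regs s3 y = regs s2 y"
      by (auto simp: runs_code_def Let_def)
    have "(step w D P ^^ (t3 + Suc t1)) s = s3"
      using t1(2) t3(2) s2_def by (simp add: funpow_add funpow_swap1)
    then show ?thesis
      unfolding runs_code_def Let_def code
      by (intro exI[of _ "t3 + Suc t1"]) (use t1 t3 s2 True in \<open>auto simp: q_def\<close>)
  next
    case False
    obtain t3 s3 where t3: "t3 \<le> length ca" "s3 = (step w D P ^^ t3) s2"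
      "pc s3 = length pre + length cc + 1 + length ca" "regs s3 r = ev w D i j a"
      "\<forall>y<r. regs s3 y = regs s2 y"
      using Ite.IH(2)[of "pre @ cc @ [Jump_Zero r q]" r "Jump (q + length cb) # cb @ post" s2]
        Ite.prems(2-5) P t1(3-5) s2 False
      by (auto simp: runs_code_def Let_def ca_def)
    have st: "step w D P s3 = s3\<lparr>pc := q + length cb\<rparr>"
      using step_at[of P "pre @ cc @ Jump_Zero r q # ca" "Jump (q + length cb)" _ s3 w D] P t3 by simp
    have "(step w D P ^^ (Suc (t3 + Suc t1))) s = s3\<lparr>pc := q + length cb\<rparr>"
      using t1(2) t3(2) s2_def st by (simp add: funpow_add funpow_swap1[symmetric])
    then show ?thesis
      unfolding runs_code_def Let_def code
      by (intro exI[of _ "Suc (t3 + Suc t1)"]) (use t1 t3 s2 False in \<open>auto simp: q_def simp del: funpow.simps\<close>)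
  qed
qed

text \<open>The time bound depends on the expression alone, so any fixed query expression is a
  constant-time program. Subterms shared by a \<open>let\<close> are compiled repeatedly, which only
  changes the constant.\<close>

lemma exp_program:
  "\<exists>P T. \<forall>w D i j. answers w D P T i j (ev w D i j e)"
proof -
  define P where "P = compile e 2 0 @ [Op BOr 0 2 2]"
  have "answers w D P (Suc (length (compile e 2 0))) i j (ev w D i j e)" for w D i j
  proof -
    have "runs_code w D P (length (compile e 2 0)) 2 (ev w D i j e) (init i j)
        (length (compile e 2 0))"
      using compile_runs[of P "[]" e 2 "[Op BOr 0 2 2]" "init i j" i j w D]
      by (simp add: P_def init_def)
    then obtain t s where t: "t \<le> length (compile e 2 0)" "s = (step w D P ^^ t) (init i j)"
      "pc s = length (compile e 2 0)" "regs s 2 = ev w D i j e"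
      by (auto simp: runs_code_def Let_def)
    have "step w D P s = set_reg 0 (ev w D i j e) s"
      using step_at[of P "compile e 2 0" "Op BOr 0 2 2" "[]" s w D] t by (simp add: P_def)
    then show ?thesis
      unfolding answers_def Let_def
      by (intro exI[of _ "Suc t"]) (use t in \<open>simp add: halted_def P_def set_reg_def\<close>)
  qed
  then show ?thesis by blast
qed

section \<open>Words of arbitrary length\<close>

lemma word_at_eq:
  "word_at w D a = take_bit w (drop_bit (a * w) (horner_sum of_bool 2 D :: nat))"
  by (rule bit_eqI) (auto simp: word_at_def bit_simps bit_horner_sum_bit_iff add.commute)

lemma horner_sum_less_power:
  fixes M :: nat
  assumes "\<forall>x\<in>set V. x < M"
  shows "horner_sum id M V < M ^ length V"
  using assms
proof (induction V)
  case (Cons x V)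
  have "x + M * horner_sum id M V < M + M * horner_sum id M V"
    using Cons.prems by simp
  also have "\<dots> = M * Suc (horner_sum id M V)"
    by simp
  also have "\<dots> \<le> M * M ^ length V"
    using Cons by (intro mult_le_mono) (auto simp: Suc_le_eq id_def)
  finally show ?case by (simp add: id_def)
qed simp

lemma horner_sum_digit:
  fixes M :: nat
  assumes "\<forall>x\<in>set V. x < M" "a < length V"
  shows "horner_sum id M V div M ^ a mod M = V ! a"
  using assms
proof (induction V arbitrary: a)
  case (Cons x V)
  then have M: "0 < M" "x < M" by auto
  then have *: "(x + M * horner_sum id M V) div M = horner_sum id M V"
    by simp
  show ?case
  proof (cases a)
    case 0
    then show ?thesis using M by simp
  next
    case (Suc b)
    then show ?thesis
      using Cons.IH[of b] Cons.prems * by (simp add: div_mult2_eq)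
  qed
qed simp

text \<open>The list is read as the digits of one number in base \<open>2 ^ L\<close>, so that
  fetching a word becomes extracting a digit.\<close>

definition bits_of_words :: "nat \<Rightarrow> nat list \<Rightarrow> bool list" where
  "bits_of_words L V = map (bit (horner_sum id (2 ^ L) V)) [0..<length V * L]"

lemma length_bits_of_words [simp]: "length (bits_of_words L V) = length V * L"
  by (simp add: bits_of_words_def)

lemma word_at_bits_of_words:
  assumes "\<forall>x\<in>set V. x < 2 ^ L" "a < length V"
  shows "word_at L (bits_of_words L V) a = V ! a"
proof -
  have "horner_sum id (2 ^ L) V < (2 ^ L) ^ length V"
    using assms(1) by (rule horner_sum_less_power)
  then have "horner_sum id (2 ^ L) V < 2 ^ (length V * L)"
    by (simp add: power_mult[symmetric] mult.commute)
  then have *: "horner_sum of_bool 2 (bits_of_words L V) = horner_sum id (2 ^ L) V"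
    by (simp add: bits_of_words_def horner_sum_bit_eq_take_bit take_bit_nat_eq_self)
  show ?thesis
    using horner_sum_digit[OF assms]
    by (simp add: word_at_eq * take_bit_eq_mod drop_bit_eq_div power_mult mult.commute)
qed

lemma word_at_less: "word_at w D a < 2 ^ w"
  by (simp add: word_at_eq)

section \<open>Bit identities and a bound for unaligned reads\<close>

lemma complement_and_eq_0:
  fixes y :: nat
  assumes "y < 2 ^ k"
  shows "y AND (2 ^ k - 1 - y) = 0"
  using assms
proof (induction k arbitrary: y)
  case (Suc k)
  define K :: nat where "K = 2 ^ k"
  have e: "(2 * K - Suc y) div 2 = K - Suc (y div 2)"
    using Suc.prems by (auto simp: K_def[symmetric])
  have o: "odd y \<Longrightarrow> even (2 * K - 1 - y)"
    using Suc.prems by (auto simp: K_def[symmetric])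
  have "y div 2 AND (2 ^ k - 1 - y div 2) = 0"
    by (rule Suc.IH) (use Suc.prems in auto)
  then have "y AND (2 * K - 1 - y) = 0"
    using o by (subst and_rec) (auto simp: e K_def[symmetric])
  then show ?case
    by (simp add: K_def)
qed simp

text \<open>The isolation of the lowest set bit as \<open>x AND - x\<close> in two's complement:
  above bit \<open>e\<close> the negative modulo \<open>2 ^ w\<close> is the complement of
  \<open>x\<close>, below it both are zero.\<close>

lemma lowest_set_bit:
  fixes y :: nat
  assumes "2 ^ e * (2 * y + 1) < 2 ^ w"
  shows "2 ^ e * (2 * y + 1) AND (2 ^ w - 2 ^ e * (2 * y + 1)) = 2 ^ e"
proof -
  have "(2::nat) ^ e * 1 \<le> 2 ^ e * (2 * y + 1)"
    by (intro mult_le_mono) auto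
  then have "(2::nat) ^ e < 2 ^ w"
    using assms by linarith
  then have ew: "e < w" by simp
  define k where "k = w - Suc e"
  have w: "w = Suc (e + k)" using ew by (simp add: k_def)
  have y: "y < 2 ^ k"
  proof (rule ccontr)
    assume "\<not> y < 2 ^ k"
    then have "(2::nat) ^ e * (2 * 2 ^ k) \<le> 2 ^ e * (2 * y + 1)"
      by (intro mult_le_mono) auto
    then show False using assms by (simp add: w power_add algebra_simps)
  qed
  define z where "z = 2 ^ k - 1 - y"
  have yz: "y + z + 1 = 2 ^ k" using y by (simp add: z_def)
  have "(2::nat) ^ w = 2 ^ e * (2 * (y + z + 1))"
    unfolding yz by (simp add: w power_add)
  then have "2 ^ w - 2 ^ e * (2 * y + 1) = 2 ^ e * (2 * z + 1)"
    by (simp add: algebra_simps)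
  moreover have "(2 * y + 1) AND (2 * z + 1) = 1"
    using complement_and_eq_0[OF y] by (subst and_rec) (simp add: z_def)
  ultimately show ?thesis
    by (metis mult.commute mult_1 push_bit_and push_bit_eq_mult)
qed

text \<open>An unaligned word consists of the high bits of one machine word and the low bits of the
  next. For \<open>off = 0\<close> the second part is shifted out entirely, which is then
  correct.\<close>

lemma two_word_extract:
  fixes Y :: nat
  assumes "off < w"
  shows "drop_bit off (take_bit w Y) OR take_bit w (push_bit (w - off) (take_bit w (drop_bit w Y)))
       = take_bit w (drop_bit off Y)"
  by (rule bit_eqI) (use assms in \<open>auto simp: bit_simps add.commute\<close>)

text \<open>Keeps the product of a residue modulo \<open>w\<close> and a length
  \<open>L \<le> w\<close> within a word. The factor \<open>w - 1\<close> matters: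
  \<open>w * w < 2 ^ w\<close> fails for \<open>w\<close> from 2 to 4.\<close>

lemma mult_self_less_exp: "(w - 1) * w < (2::nat) ^ w"
proof (cases "w < 4")
  case True
  then have "w = 0 \<or> w = 1 \<or> w = 2 \<or> w = 3" by auto
  then show ?thesis by auto
next
  case False
  then have "4 \<le> w" by simp
  then show ?thesis
  proof (induction w rule: dec_induct)
    case (step m)
    have "(Suc m - 1) * Suc m = (m - 1) * m + 2 * m"
      using step.hyps by (cases m) auto
    also have "2 * m \<le> (m - 1) * m"
      using step.hyps by (intro mult_le_mono) auto
    finally show ?case using step by simp
  qed simp
qed

text \<open>
  A memory of words of \<open>L \<le> w\<close> bits is simulated on top of the words of \<open>w\<close> bits, so that the space
  does not depend on \<open>w\<close>.  Its first word is \<open>2 ^ s * (2 * L + 1)\<close>: the lowest set bit yields \<open>2 ^ s\<close>,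
  and the \<open>s\<close> bits above it yield \<open>L\<close>.
\<close>

definition header_exp :: exp where
  "header_exp = Prb (Cst 0)"

definition radix_exp :: exp where
  "radix_exp = Bin BAnd header_exp (Bin Sub (Cst 0) header_exp)"

definition len_exp :: exp where
  "len_exp = Bin Mod (Bin Div (Bin Div header_exp radix_exp) (Cst 2)) radix_exp"

text \<open>
  The bit address \<open>a * L\<close> may exceed \<open>2 ^ w\<close>; splitting \<open>a\<close> by \<open>w\<close> first keeps all intermediate
  results below \<open>2 ^ w\<close>.  For \<open>L = w\<close> the final reduction is modulo \<open>0\<close>, which is the identity.
\<close>

definition vprobe :: "exp \<Rightarrow> exp" where
  "vprobe a =
    (let t = Bin Mul (Bin Mod a WSize) len_exp;
         k = Bin Add (Bin Mul (Bin Div a WSize) len_exp) (Bin Div t WSize);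
         off = Bin Mod t WSize
     in Bin Mod (Bin BOr (Bin Shr (Prb k) off)
                  (Bin Shl (Prb (Bin Add k (Cst 1))) (Bin Sub WSize off)))
          (Bin Shl (Cst 1) len_exp))"

section \<open>Evaluation of expressions without overflow\<close>

context
  fixes w :: nat and D :: "bool list" and i j :: nat
begin

lemma ev_add: "ev w D i j a = x \<Longrightarrow> ev w D i j b = y \<Longrightarrow> x + y < 2 ^ w \<Longrightarrow>
    ev w D i j (Bin Add a b) = x + y"
  by (simp add: take_bit_nat_eq_self)

lemma ev_sub: "ev w D i j a = x \<Longrightarrow> ev w D i j b = y \<Longrightarrow> x < 2 ^ w \<Longrightarrow> y \<le> x \<Longrightarrow>
    ev w D i j (Bin Sub a b) = x - y"
proof -
  assume *: "ev w D i j a = x" "ev w D i j b = y" "x < 2 ^ w" "y \<le> x"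
  have "(x - y + 2 ^ w) mod 2 ^ w = x - y"
    unfolding mod_add_self2 using * by (intro mod_less) simp
  moreover have "x + 2 ^ w - y = x - y + 2 ^ w" using * by simp
  ultimately have "(x + 2 ^ w - y) mod 2 ^ w = x - y" by (simp only:)
  then show ?thesis using * by (simp add: take_bit_eq_mod)
qed

lemma ev_mul: "ev w D i j a = x \<Longrightarrow> ev w D i j b = y \<Longrightarrow> x * y < 2 ^ w \<Longrightarrow>
    ev w D i j (Bin Mul a b) = x * y"
  by (simp add: take_bit_nat_eq_self)

lemma ev_cst: "k < 2 ^ w \<Longrightarrow> ev w D i j (Cst k) = k"
  by (simp add: take_bit_nat_eq_self)

lemma ev_div: "ev w D i j a = x \<Longrightarrow> ev w D i j b = y \<Longrightarrow> ev w D i j (Bin Div a b) = x div y"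
  by simp

lemma ev_mod: "ev w D i j a = x \<Longrightarrow> ev w D i j b = y \<Longrightarrow> ev w D i j (Bin Mod a b) = x mod y"
  by simp

lemma ev_shr: "ev w D i j a = x \<Longrightarrow> ev w D i j b = y \<Longrightarrow>
    ev w D i j (Bin Shr a b) = x div 2 ^ y"
  by (simp add: drop_bit_eq_div)

lemma ev_exp2: "ev w D i j b = y \<Longrightarrow> y < w \<Longrightarrow> ev w D i j (Bin Shl (Cst 1) b) = 2 ^ y"
  by (simp add: take_bit_nat_eq_self push_bit_eq_mult take_bit_push_bit)

lemma ev_shl: "ev w D i j a = x \<Longrightarrow> ev w D i j b = y \<Longrightarrow>
    ev w D i j (Bin Shl a b) = take_bit w (push_bit y x)"
  by simp

lemma ev_or: "ev w D i j a = x \<Longrightarrow> ev w D i j b = y \<Longrightarrow> ev w D i j (Bin BOr a b) = x OR y"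
  by simp

lemma ev_prb: "ev w D i j a = x \<Longrightarrow> ev w D i j (Prb a) = word_at w D x"
  by simp

lemma ev_less: "ev w D i j a = x \<Longrightarrow> ev w D i j b = y \<Longrightarrow>
    ev w D i j (Ite (Bin Less a b) c d) = (if x < y then ev w D i j c else ev w D i j d)"
  by simp

lemma ev_eq: "ev w D i j a = x \<Longrightarrow> ev w D i j b = y \<Longrightarrow>
    ev w D i j (Ite (Bin Eq a b) c d) = (if x = y then ev w D i j c else ev w D i j d)"
  by simp

end

declare ev.simps(1,5) [simp del]

locale memory =
  fixes w :: nat and D :: "bool list" and i j L s :: nat and V :: "nat list"
  assumes L_le: "L \<le> w"
    and word: "\<And>a. a < length V \<Longrightarrow> word_at L D a = V ! a"
    and V_len: "length V < 2 ^ L"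
    and V_ge: "3 \<le> length V"
    and V_0: "V ! 0 = 2 ^ s * (2 * L + 1)"
    and s_le: "2 * s + 1 \<le> L"
    and L_less: "L < 2 ^ s"
begin

abbreviation E :: "exp \<Rightarrow> nat" where "E \<equiv> ev w D i j"

lemma pow_L_le: "(2::nat) ^ L \<le> 2 ^ w"
  using L_le by (simp add: power_increasing)

text \<open>A probe returns \<open>w\<close> bits, before \<open>L\<close> is known. What follows
  the header enters as a multiple of \<open>2 ^ L\<close>, hence of \<open>2 ^ (2 * s + 1)\<close>,
  and disturbs neither the lowest set bit nor the \<open>s\<close> bits above it.\<close>

lemma E_header: "\<exists>y. E header_exp = 2 ^ s * (2 * y + 1) \<and> y mod 2 ^ s = L"
proof -
  define Z :: nat where "Z = horner_sum of_bool 2 D"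
  have h: "E header_exp = take_bit w Z"
    by (simp add: header_exp_def word_at_eq Z_def ev.simps)
  have "take_bit L Z = 2 ^ s * (2 * L + 1)"
    using word[of 0] V_ge V_0 by (cases V) (auto simp: word_at_eq Z_def)
  then have t: "take_bit L (take_bit w Z) = 2 ^ s * (2 * L + 1)"
    using L_le by simp
  define x where "x = take_bit w Z"
  define u where "u = x div 2 ^ L"
  have "x = u * 2 ^ L + 2 ^ s * (2 * L + 1)"
    using t div_mult_mod_eq[of x "2 ^ L"] by (simp add: x_def u_def take_bit_eq_mod)
  also have "(2::nat) ^ L = 2 ^ s * (2 * (2 ^ s * 2 ^ (L - (2 * s + 1))))"
    using s_le by (simp flip: power_add power_Suc add: mult_2)
  finally have "x = 2 ^ s * (2 * (u * (2 ^ s * 2 ^ (L - (2 * s + 1))) + L) + 1)"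
    by (simp add: algebra_simps)
  moreover have "(u * (2 ^ s * 2 ^ (L - (2 * s + 1))) + L) mod 2 ^ s = L"
    using L_less by (metis mod_less mod_mult_self3 mult.assoc mult.commute)
  ultimately show ?thesis
    unfolding h x_def[symmetric] by blast
qed

lemma w_pos: "1 < w"
proof -
  have "L \<noteq> 1" using s_le L_less by (cases s) auto
  then show ?thesis using s_le L_le by linarith
qed

lemma E_cst: "k \<le> w \<Longrightarrow> E (Cst k) = k"
  by (rule ev_cst) (meson le_less_trans less_exp)

lemma E_radix: "E radix_exp = 2 ^ s"
proof -
  obtain y where y: "E header_exp = 2 ^ s * (2 * y + 1)" using E_header by blast
  have lt: "E header_exp < 2 ^ w"
    by (simp add: header_exp_def ev.simps word_at_less)
  have "E (Bin Sub (Cst 0) header_exp) = 2 ^ w - E header_exp"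
    using lt y by (simp add: ev.simps take_bit_nat_eq_self)
  then show ?thesis
    using lowest_set_bit[of s y w] lt by (simp add: radix_exp_def ev.simps(5) y)
qed

lemma E_len: "E len_exp = L"
proof -
  obtain y where y: "E header_exp = 2 ^ s * (2 * y + 1)" "y mod 2 ^ s = L" using E_header by blast
  have "E (Bin Div header_exp radix_exp) = 2 * y + 1"
    by (simp add: ev.simps(5) y(1) E_radix)
  then show ?thesis
    using y(2) E_cst[of 2] w_pos by (simp add: len_exp_def ev.simps(5) E_radix)
qed

lemma E_vprobe:
  assumes a: "E e = a" "a < length V"
  shows "E (vprobe e) = V ! a"
proof -
  define Z :: nat where "Z = horner_sum of_bool 2 D"
  define t where "t = a mod w * L"
  define k where "k = a div w * L + t div w"
  define off where "off = t mod w"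
  have ab: "a + 1 < 2 ^ w" using a(2) V_len pow_L_le by linarith
  have w0: "0 < w" using w_pos by simp
  have "t \<le> (w - 1) * w"
    unfolding t_def using L_le w0
    by (intro mult_le_mono) (auto simp: less_Suc_eq_le[symmetric])
  then have t: "t < 2 ^ w" using mult_self_less_exp[of w] by linarith
  have pos: "k * w + off = a * L"
  proof -
    have "k * w + off = a div w * L * w + (t div w * w + t mod w)"
      by (simp add: k_def off_def algebra_simps)
    also have "\<dots> = (a div w * w + a mod w) * L"
      unfolding div_mult_mod_eq[of t] t_def add_mult_distrib by (simp only: mult.assoc mult.commute[of L] div_mult_mod_eq)
    also have "\<dots> = a * L"
      by (simp only: div_mult_mod_eq)
    finally show ?thesis .
  qed
  \<comment> \<open>Words of \<open>L \<le> w\<close> bits have machine addresses no larger than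
    their own, so the bound on \<open>a\<close> excludes overflow in \<open>k + 1\<close>.\<close>
  have "k * w \<le> a * w" using pos L_le by (metis le_add1 le_trans mult_le_mono2)
  then have ka: "k \<le> a" using w0 by simp
  have off: "off < w" using w0 by (simp add: off_def)
  define tE where "tE = Bin Mul (Bin Mod e WSize) len_exp"
  define kE where "kE = Bin Add (Bin Mul (Bin Div e WSize) len_exp) (Bin Div tE WSize)"
  define oE where "oE = Bin Mod tE WSize"
  have Et: "E tE = t"
    unfolding t_def tE_def
    by (intro ev_mul ev_mod a(1) E_len) (use t in \<open>auto simp: t_def\<close>)
  have Ek: "E kE = k"
    unfolding k_def kE_def
    by (intro ev_add ev_mul ev_div a(1) E_len Et) (use ka ab in \<open>auto simp: k_def\<close>)
  have Ek1: "E (Bin Add kE (Cst 1)) = k + 1"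
    by (intro ev_add Ek E_cst) (use w_pos ka ab in auto)
  have Eo: "E oE = off"
    unfolding oE_def off_def by (intro ev_mod Et) simp
  have Ewo: "E (Bin Sub WSize oE) = w - off"
    by (intro ev_sub Eo) (use off in auto)
  define x where "x = drop_bit off (word_at w D k) OR
    take_bit w (push_bit (w - off) (word_at w D (k + 1)))"
  have "x = take_bit w (drop_bit off (drop_bit (k * w) Z))"
    unfolding x_def two_word_extract[OF off, symmetric] by (simp add: word_at_eq Z_def algebra_simps)
  also have "\<dots> = take_bit w (drop_bit (a * L) Z)"
    using pos by (simp add: add.commute)
  finally have x: "x = take_bit w (drop_bit (a * L) Z)" .
  have "vprobe e = Bin Mod (Bin BOr (Bin Shr (Prb kE) oE)
      (Bin Shl (Prb (Bin Add kE (Cst 1))) (Bin Sub WSize oE))) (Bin Shl (Cst 1) len_exp)"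
    by (simp add: vprobe_def Let_def kE_def tE_def oE_def)
  also have "E \<dots> = x mod E (Bin Shl (Cst 1) len_exp)"
    unfolding x_def drop_bit_eq_div
    by (intro ev_mod ev_or ev_shr ev_shl ev_prb Ek Ek1 Eo Ewo refl)
  finally have "E (vprobe e) = x mod E (Bin Shl (Cst 1) len_exp)" .
  also have "\<dots> = take_bit L (drop_bit (a * L) Z)"
  proof (cases "L = w")
    case True
    then have "E (Bin Shl (Cst 1) len_exp) = 0"
      using E_cst[of 1] w_pos by (simp add: ev.simps(5) E_len take_bit_push_bit)
    then show ?thesis using x True by simp
  next
    case False
    then have "E (Bin Shl (Cst 1) len_exp) = 2 ^ L"
      using L_le by (intro ev_exp2[OF E_len]) auto
    then show ?thesis using x L_le by (simp add: take_bit_eq_mod[symmetric] min_def)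
  qed
  also have "\<dots> = V ! a"
    using word[OF a(2)] by (simp add: word_at_eq Z_def)
  finally show ?thesis .
qed

end

section \<open>Range minima and depths\<close>

lemma rmq_bounds:
  assumes "i \<le> j"
  shows "i \<le> rmq X i j" "rmq X i j \<le> j"
  using arg_min_if_finite(1)[of "{i..j}" X] assms by (auto simp: rmq_def)

lemma rmq_le:
  assumes "k \<in> {i..j}"
  shows "X (rmq X i j) \<le> X k"
  using arg_min_least[of "{i..j}" k X] assms by (auto simp: rmq_def)

lemma rmq_eqI:
  assumes "inj_on X {i..j}" "p \<in> {i..j}" "\<And>k. k \<in> {i..j} \<Longrightarrow> X p \<le> X k"
  shows "rmq X i j = p"
proof -
  have "i \<le> j" using assms(2) by simp
  then have "rmq X i j \<in> {i..j}" using rmq_bounds by simp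
  moreover have "X (rmq X i j) = X p"
    using assms(2,3) rmq_le[of p i j X] calculation by (meson antisym)
  ultimately show ?thesis using assms(1,2) by (meson inj_onD)
qed

text \<open>
  The depth of position \<open>i\<close> in the tree whose parent function maps \<open>i\<close> to the nearest position to
  its left with a smaller value.
\<close>

definition depth :: "(nat \<Rightarrow> nat) \<Rightarrow> nat \<Rightarrow> nat" where
  "depth X i = card {k. k < i \<and> (\<forall>m\<in>{k<..i}. X k < X m)}"

lemma depth_le: "depth X i \<le> i"
proof -
  have "depth X i \<le> card {..<i}"
    unfolding depth_def by (rule card_mono) auto
  then show ?thesis by simp
qed

lemma depth_Suc: "depth X (Suc i) \<le> Suc (depth X i)"
proof -
  have "depth X (Suc i) \<le> card (insert i {k. k < i \<and> (\<forall>m\<in>{k<..i}. X k < X m)})"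
    unfolding depth_def by (rule card_mono) auto
  also have "\<dots> \<le> Suc (depth X i)"
    unfolding depth_def by (rule card_insert_le_m1) auto
  finally show ?thesis .
qed

text \<open>An ancestor of the minimum is smaller than it and hence lies left of \<open>i\<close>;
  being smaller than the whole range, it is an ancestor of every \<open>k\<close> in it.\<close>

lemma depth_rmq_le:
  assumes "k \<in> {i..j}"
  shows "depth X (rmq X i j) \<le> depth X k"
proof -
  let ?p = "rmq X i j"
  have p: "i \<le> ?p" "?p \<le> j" using rmq_bounds[of i j X] assms by auto
  have "a < k \<and> (\<forall>m\<in>{a<..k}. X a < X m)"
    if a: "a < ?p" "\<forall>m\<in>{a<..?p}. X a < X m" for a
  proof -
    have Xa: "X a < X ?p" using a by simp
    have "a < i"
    proof (rule ccontr)
      assume "\<not> a < i"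
      then have "X ?p \<le> X a" using a p by (intro rmq_le) auto
      then show False using Xa by simp
    qed
    moreover have "X a < X m" if m: "m \<in> {a<..k}" for m
    proof (cases "m \<le> ?p")
      case True
      then show ?thesis using a(2) m by simp
    next
      case False
      then have "X ?p \<le> X m" using m assms p by (intro rmq_le) auto
      then show ?thesis using Xa by simp
    qed
    ultimately show ?thesis using assms by auto
  qed
  then show ?thesis
    unfolding depth_def by (intro card_mono) auto
qed

text \<open>To the right of the minimum, the minimum itself is one more ancestor.\<close>

lemma depth_rmq_less:
  assumes inj: "inj_on X {i..j}" and k: "k \<in> {i..j}" "rmq X i j < k"
  shows "depth X (rmq X i j) < depth X k"
proof -
  let ?p = "rmq X i j"
  have p: "i \<le> ?p" "?p \<le> j" using rmq_bounds[of i j X] k by auto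
  have less: "X ?p < X m" if "m \<in> {?p<..k}" for m
  proof -
    have m: "m \<in> {i..j}" using that k p by auto
    have "X ?p \<le> X m" using m by (rule rmq_le)
    moreover have "X ?p \<noteq> X m" using inj_onD[OF inj, of ?p m] m p that by auto
    ultimately show ?thesis by simp
  qed
  have "insert ?p {a. a < ?p \<and> (\<forall>m\<in>{a<..?p}. X a < X m)}
      \<subseteq> {a. a < k \<and> (\<forall>m\<in>{a<..k}. X a < X m)}"
  proof -
    have "X a < X m" if a: "a < ?p" "\<forall>m\<in>{a<..?p}. X a < X m" and m: "m \<in> {a<..k}" for a m
    proof (cases "m \<le> ?p")
      case True
      then show ?thesis using a(2) m by simp
    next
      case False
      then have "X ?p < X m" using less m by simp
      moreover have "X a < X ?p" using a by simp
      ultimately show ?thesis by simp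
    qed
    then show ?thesis using k less by auto
  qed
  then have "card (insert ?p {a. a < ?p \<and> (\<forall>m\<in>{a<..?p}. X a < X m)}) \<le> depth X k"
    unfolding depth_def by (intro card_mono) auto
  then show ?thesis by (simp add: depth_def)
qed

text \<open>Ties go to the second argument, meant to be the right one: within a range, positions
  left of the minimum may share its depth, positions right of it may not.\<close>

definition shallower :: "(nat \<Rightarrow> nat) \<Rightarrow> nat \<Rightarrow> nat \<Rightarrow> nat" where
  "shallower X p q = (if depth X p < depth X q then p else q)"

text \<open>If the right range contains the overall minimum, this is its own minimum and no deeper
  than the left one. Otherwise the overall minimum is the left one, lies before the right one and is
  strictly shallower.\<close>

lemma rmq_union:
  assumes inj: "inj_on X {a..e}" and le: "a \<le> c" "c \<le> Suc b" "b \<le> e" "a \<le> b" "c \<le> e"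
  shows "rmq X a e = shallower X (rmq X a b) (rmq X c e)"
proof -
  let ?p = "rmq X a b" and ?q = "rmq X c e" and ?r = "rmq X a e"
  have p: "a \<le> ?p" "?p \<le> b" and q: "c \<le> ?q" "?q \<le> e" and r: "a \<le> ?r" "?r \<le> e"
    using rmq_bounds[of a b X] rmq_bounds[of c e X] rmq_bounds[of a e X] le by auto
  have "inj_on X {a..b}" "inj_on X {c..e}"
    using inj le by (auto elim!: inj_on_subset)
  show ?thesis
  proof (cases "?r \<in> {c..e}")
    case True
    have "?q = ?r"
      using \<open>inj_on X {c..e}\<close> True by (rule rmq_eqI) (use le in \<open>auto intro!: rmq_le\<close>)
    moreover have "depth X ?r \<le> depth X ?p"
      by (rule depth_rmq_le) (use p le in auto)
    ultimately show ?thesis by (simp add: shallower_def)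
  next
    case False
    then have rb: "?r \<in> {a..b}" "?r < ?q" using r q le by auto
    have "?p = ?r"
      using \<open>inj_on X {a..b}\<close> rb(1) by (rule rmq_eqI) (use le in \<open>auto intro!: rmq_le\<close>)
    moreover have "depth X ?r < depth X ?q"
      by (rule depth_rmq_less[OF inj]) (use q le rb in auto)
    ultimately show ?thesis by (simp add: shallower_def)
  qed
qed

text \<open>Here \<open>x\<close> is the difference of the end points rather than the length, so
  \<open>floor_log 0 = 0\<close> yields a window of length 1 for a single position. Two windows then
  cover the range but may merely touch, as for \<open>x = 1\<close>.\<close>

lemma floor_log_window:
  "2 ^ floor_log x \<le> Suc x" "x < 2 * 2 ^ floor_log x"
proof -
  show "2 ^ floor_log x \<le> Suc x"
  proof (cases "x = 0")
    case False
    then show ?thesis using floor_log_exp2_le[of x] by simp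
  qed simp
  show "x < 2 * 2 ^ floor_log x"
    using floor_log_exp2_gt[of x] by simp
qed

lemma rmq_two_windows:
  assumes "inj_on X {i..j}" "i \<le> j" "k = floor_log (j - i)"
  shows "rmq X i j = shallower X (rmq X i (i + 2 ^ k - 1)) (rmq X (j + 1 - 2 ^ k) j)"
proof -
  have "2 ^ k \<le> Suc (j - i)" "j - i < 2 * 2 ^ k" "(1::nat) \<le> 2 ^ k"
    using floor_log_window[of "j - i"] assms(3) by auto
  then show ?thesis
    using assms(2) by (intro rmq_union[OF assms(1)]) auto
qed

lemma rmq_block_windows:
  assumes "inj_on X {b * B..c * B + B - 1}" "b \<le> c" "k = floor_log (c - b)" "0 < B"
  shows "rmq X (b * B) (c * B + B - 1) =
    shallower X (rmq X (b * B) ((b + 2 ^ k) * B - 1)) (rmq X ((c + 1 - 2 ^ k) * B) (c * B + B - 1))"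
proof -
  define K :: nat where "K = 2 ^ k"
  have K: "K \<le> Suc (c - b)" "c - b < 2 * K" "1 \<le> K"
    using floor_log_window[of "c - b"] assms(3) by (auto simp: K_def)
  have 1: "b * B \<le> (c + 1 - K) * B"
    using K(1) assms(2) by (intro mult_le_mono) auto
  have 2: "(c + 1 - K) * B \<le> (b + K) * B"
    using K(2) assms(2) by (intro mult_le_mono) auto
  have 3: "(b + K) * B \<le> (c + 1) * B"
    using K(1) assms(2) by (intro mult_le_mono) auto
  have 4: "b * B + B \<le> (b + K) * B"
    using K(3) mult_le_mono1[of "b + 1" "b + K" B] by simp
  have 5: "(c + 1 - K) * B \<le> c * B"
    using K(3) by (intro mult_le_mono) auto
  \<comment> \<open>With the products replaced by variables, the side conditions become
    linear.\<close>
  have arith: "x \<le> u \<and> u \<le> Suc (v - 1) \<and> v - 1 \<le> y + B - 1 \<and> x \<le> v - 1 \<and> u \<le> y + B - 1"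
    if "x \<le> u" "u \<le> v" "v \<le> y + B" "x + B \<le> v" "u \<le> y" for x u v y
    using that assms(4) by linarith
  show ?thesis
    unfolding K_def[symmetric]
    using arith[OF 1 2 _ 4 5] 3 by (intro rmq_union[OF assms(1)]) simp_all
qed

section \<open>Blocks of large depth range\<close>

definition block_low :: "(nat \<Rightarrow> nat) \<Rightarrow> nat \<Rightarrow> nat \<Rightarrow> nat \<Rightarrow> nat" where
  "block_low X N B b = Min (depth X ` {x. x < N \<and> x div B = b})"

definition wide_block :: "(nat \<Rightarrow> nat) \<Rightarrow> nat \<Rightarrow> nat \<Rightarrow> nat \<Rightarrow> nat \<Rightarrow> bool" where
  "wide_block X N B R b \<longleftrightarrow> (\<exists>x<N. x div B = b \<and> block_low X N B b + R \<le> depth X x)"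

lemma block_low_le: "x < N \<Longrightarrow> block_low X N B (x div B) \<le> depth X x"
  unfolding block_low_def by (intro Min_le) auto

text \<open>The summand is one minus the change of depth; the truncated subtraction is exact because
  the depth grows by at most one per step.\<close>

lemma depth_drop_telescope:
  assumes "p \<le> q"
  shows "(\<Sum>x=p..<q. Suc (depth X x) - depth X (Suc x)) + depth X q = depth X p + (q - p)"
  using assms
proof (induction q rule: dec_induct)
  case (step m)
  then show ?case using depth_Suc[of X m] by simp
qed simp

text \<open>A climb by \<open>R \<ge> B\<close> within fewer than \<open>B\<close> steps is
  impossible, so the deep position precedes the one of minimal depth and the descent between them
  takes place inside the block.\<close>

lemma wide_block_drop:
  assumes "wide_block X N B R b" "B \<le> R" "0 < B"
  shows "R \<le> (\<Sum>x | x < N \<and> x div B = b. Suc (depth X x) - depth X (Suc x))"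
proof -
  obtain p where p: "p < N" "p div B = b" "block_low X N B b + R \<le> depth X p"
    using assms(1) by (auto simp: wide_block_def)
  have "block_low X N B b \<in> depth X ` {x. x < N \<and> x div B = b}"
    unfolding block_low_def by (intro Min_in) (use p in auto)
  then obtain q where q: "q < N" "q div B = b" "depth X q + R \<le> depth X p"
    using p(3) by auto
  have "p \<le> q"
  proof (rule ccontr)
    assume "\<not> p \<le> q"
    then have qp: "q < p" by simp
    have "depth X p \<le> depth X q + (p - q)"
      using depth_drop_telescope[of q p X] qp by simp
    moreover have "p - q < B"
      using dividend_less_div_times[OF assms(3), of p] div_times_less_eq_dividend[of q B] p(2) q(2) qp
      by simp
    ultimately show False using q(3) assms(2) by simp
  qed
  have "R \<le> (\<Sum>x=p..<q. Suc (depth X x) - depth X (Suc x))"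
    using depth_drop_telescope[OF \<open>p \<le> q\<close>, of X] q(3) by simp
  also have "\<dots> \<le> (\<Sum>x | x < N \<and> x div B = b. Suc (depth X x) - depth X (Suc x))"
  proof (rule sum_mono2)
    show "{p..<q} \<subseteq> {x. x < N \<and> x div B = b}"
    proof
      fix x assume x: "x \<in> {p..<q}"
      then have "p div B \<le> x div B" "x div B \<le> q div B" by (auto intro!: div_le_mono)
      then show "x \<in> {x. x < N \<and> x div B = b}" using p q x by simp
    qed
  qed auto
  finally show ?thesis .
qed

text \<open>
  Since the depth grows by at most \<open>1\<close> per step, the total descent over \<open>{..<N}\<close> is at most \<open>N\<close>,
  and every block of range at least \<open>R\<close> accounts for \<open>R\<close> of it.
\<close>

lemma card_wide_blocks:
  assumes "B \<le> R" "0 < B" "finite S" "\<And>b. b \<in> S \<Longrightarrow> wide_block X N B R b"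
  shows "card S * R \<le> N"
proof -
  define f where "f x = Suc (depth X x) - depth X (Suc x)" for x
  have "card S * R = (\<Sum>b\<in>S. R)" by simp
  also have "\<dots> \<le> (\<Sum>b\<in>S. \<Sum>x | x < N \<and> x div B = b. f x)"
    unfolding f_def using assms by (intro sum_mono wide_block_drop) auto
  also have "\<dots> = (\<Sum>x\<in>(\<Union>b\<in>S. {x. x < N \<and> x div B = b}). f x)"
    by (rule sum.UNION_disjoint[symmetric]) (use assms in auto)
  also have "\<dots> \<le> (\<Sum>x=0..<N. f x)"
    by (rule sum_mono2) auto
  also have "\<dots> \<le> N"
    using depth_drop_telescope[of 0 N X] depth_le[of X 0] by (simp add: f_def)
  finally show ?thesis .
qed

text \<open>Rank as an index: it turns the pointer of a wide block into its place in the list of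
  wide blocks.\<close>

lemma nth_filter_upt:
  assumes "P b" "b < n"
  shows "filter P [0..<n] ! length (filter P [0..<b]) = b"
    and "length (filter P [0..<b]) < length (filter P [0..<n])"
proof -
  have "[0..<n] = [0..<b] @ b # [Suc b..<n]"
    using assms(2) upt_add_eq_append[of 0 b "n - b"] by (simp add: upt_conv_Cons)
  then show "filter P [0..<n] ! length (filter P [0..<b]) = b"
    "length (filter P [0..<b]) < length (filter P [0..<n])"
    using assms(1) by (simp_all add: nth_append)
qed

section \<open>Runs\<close>

definition run_index :: "(nat \<Rightarrow> nat) \<Rightarrow> nat \<Rightarrow> nat" where
  "run_index A i = card {t. 1 \<le> t \<and> t < i \<and> A (t + 1) < A t}"

text \<open>The first position of the \<open>k\<close>-th run, counting from \<open>0\<close>; it is \<open>n\<close> if there is no such run.\<close>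

definition head :: "nat \<Rightarrow> (nat \<Rightarrow> nat) \<Rightarrow> nat \<Rightarrow> nat" where
  "head n A k = (LEAST t. 1 \<le> t \<and> (k \<le> run_index A t \<or> t = n))"

text \<open>The previous smaller value. The default \<open>0\<close> is below every
  \<open>i \<ge> 1\<close>, so \<open>i \<le> psv A x\<close> fails if nothing left of
  \<open>x\<close> is smaller.\<close>

definition psv :: "(nat \<Rightarrow> nat) \<Rightarrow> nat \<Rightarrow> nat" where
  "psv A x = Max (insert 0 {k. 1 \<le> k \<and> k < x \<and> A k < A x})"

lemma runs_eq: "runs n A = Suc (run_index A n)"
  by (simp add: runs_def run_index_def)

lemma run_index_mono: "i \<le> j \<Longrightarrow> run_index A i \<le> run_index A j"
  unfolding run_index_def by (intro card_mono) auto

lemma run_index_Suc: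
  assumes "1 \<le> i"
  shows "run_index A (Suc i) = run_index A i + of_bool (A (Suc i) < A i)"
proof -
  have "{t. 1 \<le> t \<and> t < Suc i \<and> A (t + 1) < A t} =
      (if A (Suc i) < A i then insert i else id) {t. 1 \<le> t \<and> t < i \<and> A (t + 1) < A t}"
    using assms by (auto simp: less_Suc_eq)
  then show ?thesis by (simp add: run_index_def)
qed

lemma run_index_1 [simp]: "run_index A 0 = 0" "run_index A (Suc 0) = 0"
proof -
  have "{t. 1 \<le> t \<and> t < Suc 0 \<and> A (t + 1) < A t} = {}" by auto
  then show "run_index A (Suc 0) = 0" by (simp add: run_index_def)
qed (simp add: run_index_def)

lemma run_index_diff: "i \<le> j \<Longrightarrow> run_index A j \<le> run_index A i + (j - i)"
proof (induction j rule: dec_induct)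
  case (step m)
  then show ?case using run_index_Suc[of m A] by (cases m) auto
qed simp

lemma run_index_le: "run_index A i \<le> i"
  using run_index_diff[of 0 i A] by simp

lemma le_in_run:
  assumes "1 \<le> a" "a \<le> b" "run_index A a = run_index A b"
  shows "A a \<le> A b"
  using assms(2,3)
proof (induction b rule: dec_induct)
  case (step m)
  have "run_index A a \<le> run_index A m" "run_index A m \<le> run_index A (Suc m)"
    using step.hyps by (auto intro: run_index_mono)
  then have "run_index A a = run_index A m" "\<not> A (Suc m) < A m"
    using step.prems run_index_Suc[of m A] assms(1) step.hyps by auto
  then show ?case using step.IH by simp
qed simp

context
  fixes n :: nat and A :: "nat \<Rightarrow> nat"
  assumes n: "1 \<le> n"
begin

lemma head_bounds: "1 \<le> head n A k" "head n A k \<le> n"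
proof -
  let ?Q = "\<lambda>t. 1 \<le> t \<and> (k \<le> run_index A t \<or> t = n)"
  have "?Q n" using n by simp
  then have "?Q (head n A k)" "head n A k \<le> n"
    unfolding head_def by (rule LeastI, rule Least_le)
  then show "1 \<le> head n A k" "head n A k \<le> n" by auto
qed

text \<open>A Galois connection: \<open>head n A\<close> is the lower adjoint of
  \<open>run_index A\<close>.\<close>

lemma head_le_iff:
  assumes "k \<le> run_index A n" "1 \<le> t" "t \<le> n"
  shows "head n A k \<le> t \<longleftrightarrow> k \<le> run_index A t"
proof
  let ?Q = "\<lambda>t. 1 \<le> t \<and> (k \<le> run_index A t \<or> t = n)"
  assume "head n A k \<le> t"
  have "?Q n" using n by simp
  then have "?Q (head n A k)"
    unfolding head_def by (rule LeastI)
  then have "k \<le> run_index A (head n A k)" using assms(1) by auto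
  also have "\<dots> \<le> run_index A t" using \<open>head n A k \<le> t\<close> by (rule run_index_mono)
  finally show "k \<le> run_index A t" .
next
  assume "k \<le> run_index A t"
  then show "head n A k \<le> t"
    unfolding head_def by (intro Least_le) (use assms in simp)
qed

lemma run_index_head:
  assumes "k \<le> run_index A n"
  shows "run_index A (head n A k) = k"
proof (rule antisym)
  show "k \<le> run_index A (head n A k)"
    using head_le_iff[OF assms head_bounds(1,2)[of k]] by simp
  show "run_index A (head n A k) \<le> k"
  proof (cases "head n A k = 1")
    case False
    define t where "t = head n A k - 1"
    have t: "1 \<le> t" "t \<le> n" "head n A k = Suc t"
      using False head_bounds[of k] by (auto simp: t_def)
    then have "\<not> k \<le> run_index A t"
      using head_le_iff[OF assms t(1,2)] by simp
    then show ?thesis using run_index_Suc[OF t(1), of A] t(3) by simp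
  qed simp
qed

lemma head_beyond:
  assumes "run_index A n < k"
  shows "head n A k = n"
proof -
  have "(1 \<le> t \<and> (k \<le> run_index A t \<or> t = n)) \<longleftrightarrow> t = n" if "t \<le> n" for t
    using assms n run_index_mono[OF that, of A] by auto
  moreover have "head n A k \<le> n" by (rule head_bounds)
  moreover have "1 \<le> head n A k \<and> (k \<le> run_index A (head n A k) \<or> head n A k = n)"
    unfolding head_def by (rule LeastI[of _ n]) (use n in simp)
  ultimately show ?thesis by blast
qed

lemma inj_on_head: "inj_on (head n A) {..run_index A n}"
  by (rule inj_on_inverseI[of _ "run_index A"]) (simp add: run_index_head)

lemma head_run_le:
  assumes "1 \<le> x" "x \<le> n"
  shows "A (head n A (run_index A x)) \<le> A x"
proof (rule le_in_run[of _ _ A])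
  have k: "run_index A x \<le> run_index A n" using assms by (intro run_index_mono)
  show "head n A (run_index A x) \<le> x" using head_le_iff[OF k assms] by simp
  show "run_index A (head n A (run_index A x)) = run_index A x" using run_index_head[OF k] .
  show "1 \<le> head n A (run_index A x)" by (rule head_bounds)
qed

lemma rmq_same_run:
  assumes "inj_on A {1..n}" "1 \<le> i" "i \<le> j" "j \<le> n" "run_index A i = run_index A j"
  shows "rmq A i j = i"
proof (rule rmq_eqI)
  show "inj_on A {i..j}" using assms(1) by (rule inj_on_subset) (use assms in auto)
  fix k assume k: "k \<in> {i..j}"
  have "run_index A i \<le> run_index A k" "run_index A k \<le> run_index A j"
    using k by (auto intro: run_index_mono)
  then show "A i \<le> A k" using k assms by (intro le_in_run[of i k A]) auto
qed (use assms in auto)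

text \<open>The head \<open>h\<close> of run \<open>m\<close> is minimal among all positions in
  later runs than that of \<open>i\<close>. If \<open>i \<le> psv A h\<close>, that smaller position
  must hence belong to the run of \<open>i\<close>, so \<open>A i \<le> A (psv A h) < A h\<close>.
  Conversely, \<open>A i < A h\<close> makes \<open>i\<close> a candidate for
  \<open>psv A h\<close>.\<close>

lemma rmq_different_runs:
  assumes inj: "inj_on A {1..n}" and ij: "1 \<le> i" "i \<le> j" "j \<le> n"
    and less: "run_index A i < run_index A j"
    and m: "m = rmq (\<lambda>k. A (head n A k)) (Suc (run_index A i)) (run_index A j)"
  shows "rmq A i j = (if i \<le> psv A (head n A m) then i else head n A m)"
proof -
  let ?h = "head n A m"
  have m_bounds: "Suc (run_index A i) \<le> m" "m \<le> run_index A j"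
    using rmq_bounds[of "Suc (run_index A i)" "run_index A j"] less m by auto
  have jn: "run_index A j \<le> run_index A n" using ij by (intro run_index_mono)
  have hj: "?h \<le> j" using head_le_iff[of m j] m_bounds jn ij by simp
  have hi: "i < ?h" using head_le_iff[of m i] m_bounds jn ij by (simp add: not_le[symmetric])
  have head_min: "A ?h \<le> A x" if "1 \<le> x" "x \<le> j" "run_index A i < run_index A x" for x
  proof -
    have "A ?h \<le> A (head n A (run_index A x))"
      unfolding m using that run_index_mono[of x j A]
      by (intro rmq_le[of _ _ _ "\<lambda>k. A (head n A k)"]) auto
    also have "\<dots> \<le> A x" using that ij by (intro head_run_le) auto
    finally show ?thesis .
  qed
  have dich: "A i \<le> A x \<or> A ?h \<le> A x" if "x \<in> {i..j}" for x
  proof (cases "run_index A x = run_index A i")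
    case True
    then show ?thesis using that ij le_in_run[of i x A] by simp
  next
    case False
    then have "run_index A i < run_index A x"
      using run_index_mono[of i x A] that by simp
    then show ?thesis using head_min[of x] that ij by simp
  qed
  have injij: "inj_on A {i..j}" using inj by (rule inj_on_subset) (use ij in auto)
  let ?S = "insert 0 {k. 1 \<le> k \<and> k < ?h \<and> A k < A ?h}"
  have fin: "finite ?S" by simp
  show ?thesis
  proof (cases "i \<le> psv A ?h")
    case True
    have "psv A ?h \<in> ?S" unfolding psv_def by (rule Max_in[OF fin]) simp
    then have p: "psv A ?h < ?h" "A (psv A ?h) < A ?h" using True ij by auto
    have "\<not> run_index A i < run_index A (psv A ?h)"
      using head_min[of "psv A ?h"] p True ij hj by auto
    then have "run_index A i = run_index A (psv A ?h)"
      using run_index_mono[OF True, of A] by simp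
    then have "A i \<le> A (psv A ?h)" using ij True by (intro le_in_run[of i _ A]) auto
    then have "A i < A ?h" using p by simp
    then have "A i \<le> A x" if "x \<in> {i..j}" for x
      using dich[OF that] by linarith
    then have "rmq A i j = i"
      using ij by (intro rmq_eqI[OF injij]) simp_all
    then show ?thesis using True by simp
  next
    case False
    have "\<not> A i < A ?h"
    proof
      assume "A i < A ?h"
      then have "i \<in> ?S" using ij hi by simp
      then have "i \<le> psv A ?h" unfolding psv_def by (rule Max_ge[OF fin])
      then show False using False by simp
    qed
    then have "A ?h \<le> A x" if "x \<in> {i..j}" for x
      using dich[OF that] by linarith
    then have "rmq A i j = ?h"
      using hi hj by (intro rmq_eqI[OF injij]) simp_all
    then show ?thesis using False by simp
  qed
qed

text \<open>
  If the next head after the start of the block of \<open>i\<close> is not beyond \<open>i\<close>, it lies in that block, so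
  the counts within the block can be tabulated per head instead of per block.
\<close>

lemma run_index_by_block:
  assumes b: "0 < b" and i: "1 \<le> i" "i \<le> n"
    and r: "r = run_index A (i div b * b)" and c: "c = head n A (Suc r) div b"
  shows "run_index A i = (if i < head n A (Suc r) then r
    else r + (run_index A (c * b + i mod b) - run_index A (c * b)))"
proof (cases "i < head n A (Suc r)")
  case True
  have ge: "r \<le> run_index A i" unfolding r by (intro run_index_mono) simp
  have "run_index A i \<le> r"
  proof (cases "Suc r \<le> run_index A n")
    case True
    then show ?thesis
      using head_le_iff[OF True i] \<open>i < head n A (Suc r)\<close> by simp
  next
    case False
    then show ?thesis using run_index_mono[OF i(2), of A] by simp
  qed
  then show ?thesis using ge True by simp
next
  case False
  then have hi: "head n A (Suc r) \<le> i" by simp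
  have "i div b * b \<le> head n A (Suc r)"
  proof (cases "Suc r \<le> run_index A n")
    case True
    have "run_index A (head n A (Suc r)) = Suc r" using run_index_head[OF True] .
    then show ?thesis
      using run_index_mono[of "head n A (Suc r)" "i div b * b" A] r by (cases "head n A (Suc r) \<le> i div b * b") auto
  next
    case False
    \<comment> \<open>The default value of \<open>head\<close> matters here: since the head is not
      beyond \<open>i\<close>, it forces \<open>i = n\<close>.\<close>
    then have "head n A (Suc r) = n" by (intro head_beyond) simp
    then show ?thesis using i(2) by (metis div_times_less_eq_dividend le_trans)
  qed
  then have "i div b \<le> c" unfolding c using b by (simp add: less_eq_div_iff_mult_less_eq)
  moreover have "c \<le> i div b" unfolding c using hi by (rule div_le_mono)
  ultimately have "c = i div b" by simp
  moreover have "r \<le> run_index A i" unfolding r by (intro run_index_mono) simp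
  ultimately show ?thesis using False r by simp
qed

end

section \<open>Range minimum queries without the array\<close>

lemma div_mult_add_less: "c < m \<Longrightarrow> (b * m + c) div m = b"
  and mod_mult_add_less: "c < m \<Longrightarrow> (b * m + c) mod m = c"
  for b c m :: nat
  by simp_all

text \<open>Segment \<open>t\<close> of the memory \<open>V\<close> starts at the address held in word \<open>3 + t\<close>.\<close>

definition stored :: "nat list \<Rightarrow> nat \<Rightarrow> nat list \<Rightarrow> bool" where
  "stored V t S \<longleftrightarrow> (\<forall>k<length S. V ! (3 + t) + k < length V \<and> V ! (V ! (3 + t) + k) = S ! k)"

text \<open>
  \<open>K\<close> records of \<open>m\<close> fields of \<open>s\<close> bits, with as many whole records in a word as fit.
\<close>

definition pack :: "nat \<Rightarrow> nat \<Rightarrow> nat \<Rightarrow> nat \<Rightarrow> (nat \<Rightarrow> nat \<Rightarrow> nat) \<Rightarrow> nat list" where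
  "pack L s m K f = (let q = L div (s * m) in
     map (\<lambda>a. horner_sum id (2 ^ s) (map (\<lambda>u. f (a * q + u div m) (u mod m) mod 2 ^ s) [0..<q * m]))
       [0..<K div q + 1])"

lemma pack_less:
  assumes "x \<in> set (pack L s m K f)"
  shows "x < 2 ^ L"
proof -
  define q where "q = L div (s * m)"
  obtain a where a: "x = horner_sum id (2 ^ s) (map (\<lambda>u. f (a * q + u div m) (u mod m) mod 2 ^ s) [0..<q * m])"
    using assms by (auto simp: pack_def Let_def q_def)
  have "x < (2 ^ s) ^ (q * m)"
    unfolding a by (rule order.strict_trans2[OF horner_sum_less_power]) auto
  also have "\<dots> = 2 ^ (q * (s * m))"
    by (simp add: power_mult[symmetric] mult_ac)
  also have "\<dots> \<le> 2 ^ L"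
    unfolding q_def by (intro power_increasing) auto
  finally show ?thesis .
qed

lemma pack_nth:
  assumes "0 < s" "0 < m" "s * m \<le> L" "i < K" "c < m" "q = L div (s * m)"
  shows "i div q < length (pack L s m K f)"
    and "pack L s m K f ! (i div q) div 2 ^ (s * (i mod q * m + c)) mod 2 ^ s = f i c mod 2 ^ s"
proof -
  have q: "0 < q" using assms by (simp add: div_greater_zero_iff)
  have "i div q \<le> K div q" using assms(4) by (intro div_le_mono) simp
  then have i: "i div q < K div q + 1" by simp
  show "i div q < length (pack L s m K f)"
    using i assms(6) by (simp add: pack_def Let_def)
  define u where "u = i mod q * m + c"
  have "u < (i mod q + 1) * m" using assms(5) by (simp add: u_def)
  also have "\<dots> \<le> q * m" using q by (intro mult_le_mono) (auto simp: Suc_le_eq)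
  finally have u: "u < q * m" .
  have "pack L s m K f ! (i div q) =
      horner_sum id (2 ^ s) (map (\<lambda>u. f (i div q * q + u div m) (u mod m) mod 2 ^ s) [0..<q * m])"
    using i assms(6) by (simp add: pack_def Let_def del: upt_Suc)
  then have "pack L s m K f ! (i div q) div (2 ^ s) ^ u mod 2 ^ s =
      map (\<lambda>u. f (i div q * q + u div m) (u mod m) mod 2 ^ s) [0..<q * m] ! u"
    by (simp only:) (rule horner_sum_digit, use u in auto)
  also have "\<dots> = f (i div q * q + u div m) (u mod m) mod 2 ^ s"
    using u by simp
  also have "\<dots> = f i c mod 2 ^ s"
    using assms(2,5) by (simp add: u_def)
  finally show "pack L s m K f ! (i div q) div 2 ^ (s * (i mod q * m + c)) mod 2 ^ s = f i c mod 2 ^ s"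
    by (simp add: u_def power_mult)
qed

text \<open>The header yields only \<open>2 ^ s\<close>; the exponent is stored as well because the
  machine has no logarithm.\<close>

definition width_exp :: exp where
  "width_exp = vprobe (Cst 1)"

definition mode_exp :: exp where
  "mode_exp = vprobe (Cst 2)"

definition segment_exp :: "nat \<Rightarrow> exp \<Rightarrow> exp" where
  "segment_exp t e = vprobe (Bin Add (vprobe (Cst (3 + t))) e)"

definition field_exp :: "nat \<Rightarrow> exp \<Rightarrow> exp \<Rightarrow> exp \<Rightarrow> exp" where
  "field_exp t m e c =
    (let q = Bin Div len_exp (Bin Mul width_exp m)
     in Bin Mod (Bin Shr (segment_exp t (Bin Div e q))
          (Bin Mul width_exp (Bin Add (Bin Mul (Bin Mod e q) m) c))) radix_exp)"

locale indexed_memory = memory +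
  assumes V_10: "10 \<le> length V"
    and L_10: "10 \<le> L"
    and V_1: "V ! 1 = s"
    and s_pos: "0 < s"
begin

lemma w_less: "w < 2 ^ w"
  by simp

lemma E_width: "E width_exp = s"
  unfolding width_exp_def V_1[symmetric] using V_10 L_10 L_le by (intro E_vprobe E_cst) auto

lemma E_mode: "E mode_exp = V ! 2"
  unfolding mode_exp_def using V_10 L_10 L_le by (intro E_vprobe E_cst) auto

lemma stored_index_less:
  assumes "stored V t S" "k < length S"
  shows "k < 2 ^ L" "k < 2 ^ w"
proof -
  have "V ! (3 + t) + k < length V" using assms by (simp add: stored_def)
  then show "k < 2 ^ L" using V_len by linarith
  then show "k < 2 ^ w" using pow_L_le by linarith
qed

lemma E_segment:
  assumes S: "stored V t S" "t < 7" and e: "E e = k" "k < length S"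
  shows "E (segment_exp t e) = S ! k"
proof -
  let ?b = "V ! (3 + t)"
  have k: "?b + k < length V" "V ! (?b + k) = S ! k"
    using S(1) e(2) by (auto simp: stored_def)
  have "E (vprobe (Cst (3 + t))) = ?b"
    using S(2) V_10 L_10 L_le by (intro E_vprobe E_cst) auto
  then have "E (Bin Add (vprobe (Cst (3 + t))) e) = ?b + k"
    by (rule ev_add[OF _ e(1)]) (use k V_len pow_L_le in linarith)
  then show ?thesis
    unfolding segment_exp_def k(2)[symmetric] using k(1) by (rule E_vprobe)
qed

lemma E_field:
  assumes S: "stored V t (pack L s m K f)" "t < 7"
    and e: "E em = m" "E e = x" "E ec = c" "x < K" "c < m" "s * m \<le> L"
  shows "E (field_exp t em e ec) = f x c mod 2 ^ s"
proof -
  define q where "q = L div (s * m)"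
  define u where "u = x mod q * m + c"
  have m: "0 < m" using e(5) by simp
  have q: "0 < q" using e(6) s_pos m by (simp add: q_def div_greater_zero_iff)
  have "u < (x mod q + 1) * m" using e(5) by (simp add: u_def)
  also have "\<dots> \<le> q * m" using q by (intro mult_le_mono) (auto simp: Suc_le_eq)
  finally have "s * u \<le> s * (q * m)" by simp
  also have "\<dots> = q * (s * m)" by simp
  also have "\<dots> \<le> L" unfolding q_def by simp
  finally have su: "s * u \<le> L" .
  have "1 * u \<le> s * u" using s_pos by (intro mult_le_mono) auto
  then have u: "u \<le> L" using su by linarith
  have Lw: "L < 2 ^ w" using L_le w_less by linarith
  define qE where "qE = Bin Div len_exp (Bin Mul width_exp em)"
  have Eq: "E qE = q"
    unfolding qE_def q_def by (intro ev_div ev_mul E_len E_width e(1)) (use e(6) Lw in linarith)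
  have Ei: "E (Bin Div e qE) = x div q" by (intro ev_div Eq e)
  have Eu: "E (Bin Add (Bin Mul (Bin Mod e qE) em) ec) = u"
    unfolding u_def by (intro ev_add ev_mul ev_mod Eq e) (use u Lw in \<open>auto simp: u_def\<close>)
  have Es: "E (Bin Mul width_exp (Bin Add (Bin Mul (Bin Mod e qE) em) ec)) = s * u"
    by (intro ev_mul E_width Eu) (use su Lw in linarith)
  note p = pack_nth[OF s_pos m e(6,4,5) q_def, of f]
  have "field_exp t em e ec = Bin Mod (Bin Shr (segment_exp t (Bin Div e qE))
          (Bin Mul width_exp (Bin Add (Bin Mul (Bin Mod e qE) em) ec))) radix_exp"
    by (simp add: field_exp_def Let_def qE_def)
  also have "E \<dots> = pack L s m K f ! (x div q) div 2 ^ (s * u) mod 2 ^ s"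
    by (intro ev_mod ev_shr E_segment[OF S] Ei p(1) Es E_radix)
  finally show ?thesis
    using p(2) by (simp add: u_def)
qed

end

text \<open>
  The index for range minima of \<open>X\<close> on \<open>{..<N}\<close>.  The record of a position has its depth relative to
  its block, a table of logarithms, and the minima of the windows of length \<open>2 ^ k\<close> starting there;
  the record of a block has its minimal depth, a pointer, and the minima of the windows of \<open>2 ^ k\<close>
  blocks.  A nonzero pointer sends the blocks of large depth range, which are few, to an explicit
  table of depths.  Windows leaving \<open>{..<N}\<close> hold junk that is never read.
\<close>

definition small_record :: "(nat \<Rightarrow> nat) \<Rightarrow> nat \<Rightarrow> nat \<Rightarrow> nat \<Rightarrow> nat \<Rightarrow> nat" where
  "small_record X N B x c =
    (if c = 0 then depth X x - block_low X N B (x div B)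
     else if c = 1 then floor_log x
     else rmq X x (x + 2 ^ (c - 2) - 1) - x)"

definition block_record :: "(nat \<Rightarrow> nat) \<Rightarrow> nat \<Rightarrow> nat \<Rightarrow> nat \<Rightarrow> nat \<Rightarrow> nat \<Rightarrow> nat" where
  "block_record X N B R b c =
    (if c = 0 then block_low X N B b
     else if c = 1 then
       (if wide_block X N B R b then Suc (length (filter (wide_block X N B R) [0..<b])) else 0)
     else rmq X (b * B) ((b + 2 ^ (c - 2)) * B - 1))"

definition wide_blocks :: "(nat \<Rightarrow> nat) \<Rightarrow> nat \<Rightarrow> nat \<Rightarrow> nat \<Rightarrow> nat list" where
  "wide_blocks X N B R = filter (wide_block X N B R) [0..<N div B + 1]"

lemma length_wide_blocks:
  assumes "B \<le> R" "0 < B"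
  shows "length (wide_blocks X N B R) * R \<le> N"
proof -
  have "length (wide_blocks X N B R) = card (set (wide_blocks X N B R))"
    by (rule distinct_card[symmetric]) (simp add: wide_blocks_def)
  moreover have "card (set (wide_blocks X N B R)) * R \<le> N"
    by (rule card_wide_blocks[OF assms]) (auto simp: wide_blocks_def simp del: upt_Suc)
  ultimately show ?thesis by simp
qed

text \<open>The reductions modulo \<open>2 ^ L\<close> make junk entries fit into words and leave
  all entries that are read unchanged. With \<open>R = 2 ^ s\<close>, the relative depths outside
  the wide blocks fit into fields.\<close>

definition rmq_segments :: "nat \<Rightarrow> nat \<Rightarrow> (nat \<Rightarrow> nat) \<Rightarrow> nat \<Rightarrow> nat list list" where
  "rmq_segments L s X N = (let B = L * L; R = 2 ^ s; W = wide_blocks X N B R in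
    [pack L s (s + 2) N (small_record X N B),
     map (\<lambda>u. block_record X N B R (u div (L + 2)) (u mod (L + 2)) mod 2 ^ L)
       [0..<(N div B + 1) * (L + 2)],
     map (\<lambda>u. depth X (W ! (u div B) * B + u mod B) mod 2 ^ L) [0..<length W * B]])"

definition block_size_exp :: exp where
  "block_size_exp = Bin Mul len_exp len_exp"

definition block_exp :: "exp \<Rightarrow> exp \<Rightarrow> exp" where
  "block_exp b c = segment_exp 1 (Bin Add (Bin Mul b (Bin Add len_exp (Cst 2))) c)"

definition small_exp :: "exp \<Rightarrow> exp \<Rightarrow> exp" where
  "small_exp e c = field_exp 0 (Bin Add width_exp (Cst 2)) e c"

definition depth_exp :: "exp \<Rightarrow> exp" where
  "depth_exp e =
    (let b = Bin Div e block_size_exp; p = block_exp b (Cst 1)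
     in Ite p
       (segment_exp 2 (Bin Add (Bin Mul (Bin Sub p (Cst 1)) block_size_exp) (Bin Mod e block_size_exp)))
       (Bin Add (block_exp b (Cst 0)) (small_exp e (Cst 0))))"

definition shallower_exp :: "exp \<Rightarrow> exp \<Rightarrow> exp" where
  "shallower_exp p q = Ite (Bin Less (depth_exp p) (depth_exp q)) p q"

text \<open>The right window starts at \<open>b - (2 ^ k - 1)\<close> rather than
  \<open>b + 1 - 2 ^ k\<close>, so that no intermediate result reaches \<open>2 ^ w\<close>.\<close>

definition near_exp :: "exp \<Rightarrow> exp \<Rightarrow> exp" where
  "near_exp a b =
    (let k = small_exp (Bin Sub b a) (Cst 1);
         u = Bin Sub b (Bin Sub (Bin Shl (Cst 1) k) (Cst 1));
         c = Bin Add k (Cst 2)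
     in shallower_exp (Bin Add a (small_exp a c)) (Bin Add u (small_exp u c)))"

definition far_exp :: "exp \<Rightarrow> exp \<Rightarrow> exp" where
  "far_exp a b =
    (let k = small_exp (Bin Sub b a) (Cst 1);
         u = Bin Sub b (Bin Sub (Bin Shl (Cst 1) k) (Cst 1));
         c = Bin Add k (Cst 2)
     in shallower_exp (block_exp a c) (block_exp u c))"

text \<open>Adjacent blocks form a case of their own because \<open>far_exp\<close> requires at
  least one whole block in between.\<close>

definition rmq_exp :: "exp \<Rightarrow> exp \<Rightarrow> exp" where
  "rmq_exp a b =
    (let ba = Bin Div a block_size_exp;
         bb = Bin Div b block_size_exp;
         p = near_exp a (Bin Add (Bin Mul ba block_size_exp) (Bin Sub block_size_exp (Cst 1)));
         q = near_exp (Bin Mul bb block_size_exp) b;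
         ba1 = Bin Add ba (Cst 1)
     in Ite (Bin Eq ba bb) (near_exp a b)
         (Ite (Bin Eq ba1 bb) (shallower_exp p q)
           (shallower_exp (shallower_exp p (far_exp ba1 (Bin Sub bb (Cst 1)))) q)))"

section \<open>Correctness of the range minimum index\<close>

locale rmq_memory = indexed_memory +
  fixes X :: "nat \<Rightarrow> nat" and N :: nat
  assumes segs: "\<And>t. t < 3 \<Longrightarrow> stored V t (rmq_segments L s X N ! t)"
    and inj: "inj_on X {..<N}"
    and N_le: "N \<le> 2 ^ L"
    and radix_ge: "L ^ 3 \<le> 2 ^ s"
    and record_le: "s * (s + 2) \<le> L"
begin

definition B where "B = L * L"

lemma B_pos: "0 < B" using L_10 by (simp add: B_def)

lemma Lw: "L < 2 ^ w" using L_le w_less by linarith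

lemma B_less: "B < 2 ^ s"
proof -
  have "L * L * 1 < L * L * L" using L_10 by (intro mult_strict_left_mono) auto
  also have "\<dots> = L ^ 3" by (simp add: power3_eq_cube)
  finally show ?thesis using radix_ge by (simp add: B_def)
qed

lemma s_less_w: "s < w" using s_le L_le by linarith

lemma pow_s_less: "(2::nat) ^ s < 2 ^ w"
  using s_less_w by simp

lemma B_less_w: "B < 2 ^ w"
  using B_less pow_s_less by linarith

lemma L2_less_w: "L + 2 < 2 ^ w"
proof -
  have "L + 2 \<le> 2 * L" using L_10 by simp
  also have "\<dots> \<le> B" unfolding B_def using L_10 by (intro mult_le_mono1) simp
  finally show ?thesis using B_less_w by linarith
qed

lemma E_block_size: "E block_size_exp = B"
  unfolding block_size_exp_def B_def
  by (intro ev_mul E_len) (use B_less_w in \<open>simp add: B_def\<close>)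

lemma inj_range: "b < N \<Longrightarrow> inj_on X {a..b}"
  using inj by (rule inj_on_subset) auto

lemma N_le_w: "N \<le> 2 ^ w"
  using N_le pow_L_le by linarith

lemma E_block:
  assumes b: "E eb = b" "b \<le> N div B" and c: "E ec = c" "c < L + 2"
  shows "E (block_exp eb ec) = block_record X N B (2 ^ s) b c mod 2 ^ L"
proof -
  let ?S = "rmq_segments L s X N ! 1"
  have S: "stored V 1 ?S" using segs[of 1] by simp
  have len: "length ?S = (N div B + 1) * (L + 2)"
    by (simp add: rmq_segments_def Let_def B_def)
  have "b * (L + 2) + c < (b + 1) * (L + 2)" using c(2) by simp
  also have "\<dots> \<le> (N div B + 1) * (L + 2)" using b(2) by (intro mult_le_mono) auto
  finally have lt: "b * (L + 2) + c < length ?S" by (simp only: len)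
  have lt2: "b * (L + 2) + c < 2 ^ w" by (rule stored_index_less(2)[OF S lt])
  have EL: "E (Bin Add len_exp (Cst 2)) = L + 2"
    using w_pos L2_less_w by (intro ev_add E_len E_cst) auto
  have "E (Bin Add (Bin Mul eb (Bin Add len_exp (Cst 2))) ec) = b * (L + 2) + c"
    using lt2 by (intro ev_add[OF ev_mul[OF b(1) EL] c(1)]) linarith+
  then have "E (block_exp eb ec) = ?S ! (b * (L + 2) + c)"
    unfolding block_exp_def by (rule E_segment[OF S _ _ lt, rotated]) simp
  also have "\<dots> = block_record X N B (2 ^ s) ((b * (L + 2) + c) div (L + 2)) ((b * (L + 2) + c) mod (L + 2)) mod 2 ^ L"
    using lt unfolding len by (simp add: rmq_segments_def Let_def B_def del: upt_Suc mult_Suc_right add_2_eq_Suc')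
  finally show ?thesis
    unfolding div_mult_add_less[OF c(2)] mod_mult_add_less[OF c(2)] .
qed

lemma E_small:
  assumes "E e = x" "x < N" "E ec = c" "c < s + 2"
  shows "E (small_exp e ec) = small_record X N B x c mod 2 ^ s"
  unfolding small_exp_def
proof (rule E_field[where f = "small_record X N B" and m = "s + 2" and K = N])
  show "stored V 0 (pack L s (s + 2) N (small_record X N B))"
    using segs[of 0] by (simp add: rmq_segments_def Let_def B_def)
  show "E (Bin Add width_exp (Cst 2)) = s + 2"
    by (intro ev_add E_width E_cst) (use w_pos s_le L2_less_w in linarith)+
qed (use assms record_le in auto)

lemma E_depth:
  assumes e: "E e = x" "x < N"
  shows "E (depth_exp e) = depth X x"
proof -
  let ?W = "wide_block X N B (2 ^ s)"
  define b where "b = x div B"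
  have b: "b \<le> N div B" unfolding b_def using e(2) by (intro div_le_mono) simp
  define bE where "bE = Bin Div e block_size_exp"
  define pE where "pE = block_exp bE (Cst 1)"
  define r where "r = (if ?W b then Suc (length (filter ?W [0..<b])) else 0)"
  have Eb: "E bE = b" unfolding bE_def b_def by (intro ev_div e E_block_size)
  have xb: "b * B + x mod B = x" by (simp add: b_def)
  have d: "depth X x < 2 ^ L" using depth_le[of X x] e(2) N_le by linarith
  have "length (filter ?W [0..<b]) \<le> b"
    using length_filter_le[of ?W "[0..<b]"] by simp
  also have "b \<le> x" unfolding b_def by simp
  finally have "r \<le> N" using e(2) by (auto simp: r_def)
  have "E pE = r mod 2 ^ L"
    unfolding pE_def using E_block[OF Eb b, of "Cst 1" 1] w_pos E_cst[of 1]
    by (simp add: block_record_def r_def)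
  \<comment> \<open>The bound \<open>r \<le> N\<close> just fails to suffice when
    \<open>N = 2 ^ L\<close>; it is the rarity of wide blocks that leaves room for the offset 1 in
    pointers.\<close>
  moreover have "r < 2 ^ L"
  proof (cases "?W b")
    case True
    let ?l = "length (wide_blocks X N B (2 ^ s))"
    have lt: "length (filter ?W [0..<b]) < ?l"
      using nth_filter_upt(2)[of ?W b "N div B + 1"] True b by (simp add: wide_blocks_def)
    have "?l * 2 ^ s \<le> N"
      using B_less B_pos by (intro length_wide_blocks) auto
    moreover have "1 < (2::nat) ^ s" using s_pos by (rule one_less_power[rotated]) simp
    then have "?l * 1 < ?l * 2 ^ s" using lt by (intro mult_strict_left_mono) auto
    ultimately have "Suc (length (filter ?W [0..<b])) < 2 ^ L" using lt N_le by linarith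
    then show ?thesis using True by (simp add: r_def)
  qed (simp add: r_def)
  ultimately have Ep: "E pE = r" by simp
  have dE: "depth_exp e = Ite pE
       (segment_exp 2 (Bin Add (Bin Mul (Bin Sub pE (Cst 1)) block_size_exp) (Bin Mod e block_size_exp)))
       (Bin Add (block_exp bE (Cst 0)) (small_exp e (Cst 0)))"
    by (simp add: depth_exp_def Let_def bE_def pE_def)
  show ?thesis
  proof (cases "?W b")
    case True
    let ?S = "rmq_segments L s X N ! 2"
    have S: "stored V 2 ?S" using segs[of 2] by simp
    let ?F = "filter ?W [0..<N div B + 1]"
    have Sl: "length ?S = length ?F * B"
      by (simp add: rmq_segments_def Let_def B_def wide_blocks_def)
    define g where "g = length (filter ?W [0..<b])"
    have r: "r = Suc g" using True by (simp add: r_def g_def)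
    have g: "?F ! g = b" "g < length ?F"
      using nth_filter_upt[of ?W b "N div B + 1"] True b by (auto simp: g_def)
    have "g * B + x mod B < (g + 1) * B" using B_pos by simp
    also have "\<dots> \<le> length ?F * B" using g(2) by (intro mult_le_mono) auto
    finally have lt: "g * B + x mod B < length ?S" by (simp add: Sl)
    have "E (Bin Sub pE (Cst 1)) = g"
      using ev_sub[OF Ep E_cst[of 1]] w_pos \<open>r < 2 ^ L\<close> pow_L_le r by simp
    then have "E (Bin Add (Bin Mul (Bin Sub pE (Cst 1)) block_size_exp) (Bin Mod e block_size_exp)) = g * B + x mod B"
      using stored_index_less(2)[OF S lt] by (intro ev_add ev_mul ev_mod E_block_size e) auto
    then have "E (depth_exp e) = ?S ! (g * B + x mod B)"
      unfolding dE using Ep r E_segment[OF S _ _ lt] by simp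
    also have "\<dots> = depth X (?F ! ((g * B + x mod B) div B) * B + (g * B + x mod B) mod B) mod 2 ^ L"
      using lt unfolding Sl by (simp add: rmq_segments_def Let_def B_def wide_blocks_def)
    also have "\<dots> = depth X (?F ! g * B + x mod B) mod 2 ^ L"
      using B_pos by simp
    finally show ?thesis using g(1) xb d by simp
  next
    case False
    have le: "block_low X N B b \<le> depth X x"
      unfolding b_def using e(2) by (rule block_low_le)
    have "\<not> block_low X N B b + 2 ^ s \<le> depth X x"
      using False e(2) b_def by (auto simp: wide_block_def)
    then have lt: "depth X x - block_low X N B b < 2 ^ s" using le by simp
    have "E (block_exp bE (Cst 0)) = block_low X N B b"
      using E_block[OF Eb b E_cst[of 0]] le d by (simp add: block_record_def)
    moreover have "E (small_exp e (Cst 0)) = depth X x - block_low X N B b"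
      using E_small[OF e E_cst[of 0]] lt by (simp add: small_record_def b_def)
    ultimately have "E (Bin Add (block_exp bE (Cst 0)) (small_exp e (Cst 0))) =
        block_low X N B b + (depth X x - block_low X N B b)"
      by (rule ev_add) (use le d pow_L_le in linarith)
    then show ?thesis
      unfolding dE using Ep False le by (simp add: r_def)
  qed
qed

lemma E_shallower:
  assumes "E ep = p" "E eq = q" "p < N" "q < N"
  shows "E (shallower_exp ep eq) = shallower X p q"
  unfolding shallower_exp_def shallower_def
  using ev_less[OF E_depth[OF assms(1,3)] E_depth[OF assms(2,4)]] assms by simp

lemma E_log:
  assumes "E a = x" "E b = y" "x \<le> y" "y < N"
  shows "E (small_exp (Bin Sub b a) (Cst 1)) = floor_log (y - x)"
    and "floor_log (y - x) < L"
    and "E (Bin Sub b (Bin Sub (Bin Shl (Cst 1) (small_exp (Bin Sub b a) (Cst 1))) (Cst 1))) =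
      y + 1 - 2 ^ floor_log (y - x)"
proof -
  define k where "k = floor_log (y - x)"
  have d: "E (Bin Sub b a) = y - x"
    by (rule ev_sub[OF assms(2,1) _ assms(3)]) (use assms(4) N_le_w in linarith)
  show kL: "floor_log (y - x) < L"
  proof (cases "y - x = 0")
    case False
    then have "2 ^ floor_log (y - x) \<le> y - x" by (intro floor_log_exp2_le) simp
    also have "\<dots> < 2 ^ L" using assms(4) N_le by linarith
    finally show ?thesis by simp
  qed (use L_10 in simp)
  show k: "E (small_exp (Bin Sub b a) (Cst 1)) = floor_log (y - x)"
    using E_small[OF d _ E_cst[of 1]] w_pos assms(4) kL L_less by (simp add: small_record_def)
  have pow: "2 ^ k \<le> Suc (y - x)" unfolding k_def by (rule floor_log_window)
  have "E (Bin Shl (Cst 1) (small_exp (Bin Sub b a) (Cst 1))) = 2 ^ k"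
    unfolding k_def by (intro ev_exp2 k) (use kL L_le in simp)
  then have "E (Bin Sub (Bin Shl (Cst 1) (small_exp (Bin Sub b a) (Cst 1))) (Cst 1)) = 2 ^ k - 1"
    by (rule ev_sub) (use kL L_le w_pos E_cst[of 1] in \<open>auto simp: k_def\<close>)
  then have "E (Bin Sub b (Bin Sub (Bin Shl (Cst 1) (small_exp (Bin Sub b a) (Cst 1))) (Cst 1))) =
      y - (2 ^ k - 1)"
    by (rule ev_sub[OF assms(2)]) (use assms(3,4) N_le_w pow in linarith)+
  then show "E (Bin Sub b (Bin Sub (Bin Shl (Cst 1) (small_exp (Bin Sub b a) (Cst 1))) (Cst 1))) =
      y + 1 - 2 ^ floor_log (y - x)"
    using pow assms(3) by (simp add: k_def)
qed

lemma E_near: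
  assumes a: "E a = x" "E b = y" "x \<le> y" "y < N" "y - x < B"
  shows "E (near_exp a b) = rmq X x y"
proof -
  define k where "k = floor_log (y - x)"
  define u where "u = y + 1 - 2 ^ k"
  define kE where "kE = small_exp (Bin Sub b a) (Cst 1)"
  define uE where "uE = Bin Sub b (Bin Sub (Bin Shl (Cst 1) kE) (Cst 1))"
  note l = E_log[OF a(1-4), folded kE_def, folded uE_def, folded k_def, folded u_def]
  have pow: "2 ^ k \<le> Suc (y - x)" "y - x < 2 * 2 ^ k" "(1::nat) \<le> 2 ^ k"
    using floor_log_window[of "y - x"] by (auto simp: k_def)
  \<comment> \<open>Ranges inside a block are shorter than \<open>B < 2 ^ s\<close>, so the
    \<open>s\<close> window fields of a record are enough.\<close>
  have ks: "k < s"
  proof (cases "y - x = 0")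
    case False
    then have "2 ^ k \<le> y - x" unfolding k_def by (intro floor_log_exp2_le) simp
    then have "(2::nat) ^ k < 2 ^ s" using a(5) B_less by linarith
    then show ?thesis by simp
  qed (use s_pos k_def in simp)
  have kw: "k + 2 < 2 ^ w" using ks s_less_w w_less s_le L_le by linarith
  have c: "E (Bin Add kE (Cst 2)) = k + 2"
    by (intro ev_add l(1) E_cst) (use w_pos kw in auto)
  have win: "E (Bin Add e (small_exp e (Bin Add kE (Cst 2)))) = rmq X v (v + 2 ^ k - 1)"
    if e: "E e = v" and v: "v + 2 ^ k - 1 < N" for e v
  proof -
    let ?r = "rmq X v (v + 2 ^ k - 1)"
    have "v \<le> v + 2 ^ k - 1" using pow(3) by linarith
    then have r: "v \<le> ?r" "?r \<le> v + 2 ^ k - 1" by (rule rmq_bounds)+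
    have "?r - v < 2 ^ k" using r pow(3) by linarith
    also have "(2::nat) ^ k < 2 ^ s" using ks by simp
    finally have "E (small_exp e (Bin Add kE (Cst 2))) = ?r - v"
      using E_small[OF e _ c] v ks r by (simp add: small_record_def)
    then have "E (Bin Add e (small_exp e (Bin Add kE (Cst 2)))) = v + (?r - v)"
      using r v N_le_w by (intro ev_add e) auto
    then show ?thesis using r by simp
  qed
  have w1: "E (Bin Add a (small_exp a (Bin Add kE (Cst 2)))) = rmq X x (x + 2 ^ k - 1)"
    using a pow by (intro win) auto
  have u: "u + 2 ^ k - 1 = y" using pow a(3) by (simp add: u_def)
  have w2: "E (Bin Add uE (small_exp uE (Bin Add kE (Cst 2)))) = rmq X u y"
    using win[OF l(3)] u a(4) by simp
  have "near_exp a b = shallower_exp (Bin Add a (small_exp a (Bin Add kE (Cst 2))))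
      (Bin Add uE (small_exp uE (Bin Add kE (Cst 2))))"
    by (simp add: near_exp_def Let_def kE_def uE_def)
  also have "E \<dots> = shallower X (rmq X x (x + 2 ^ k - 1)) (rmq X u y)"
  proof (rule E_shallower[OF w1 w2])
    show "rmq X x (x + 2 ^ k - 1) < N"
      using rmq_bounds(2)[of x "x + 2 ^ k - 1" X] pow a(3,4) by linarith
    show "rmq X u y < N"
      using rmq_bounds(2)[of u y X] pow a(3,4) unfolding u_def by linarith
  qed
  also have "\<dots> = rmq X x y"
    unfolding u_def by (rule rmq_two_windows[symmetric, OF inj_range[OF a(4)] a(3) k_def])
  finally show ?thesis .
qed

lemma E_far:
  assumes a: "E a = x" "E b = y" "x \<le> y" "y * B + B - 1 < N"
  shows "E (far_exp a b) = rmq X (x * B) (y * B + B - 1)"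
proof -
  define k where "k = floor_log (y - x)"
  define u where "u = y + 1 - 2 ^ k"
  define kE where "kE = small_exp (Bin Sub b a) (Cst 1)"
  define uE where "uE = Bin Sub b (Bin Sub (Bin Shl (Cst 1) kE) (Cst 1))"
  have "y * 1 \<le> y * B" using B_pos by (intro mult_le_mono) auto
  then have y: "y < N" using a(4) B_pos by linarith
  note l = E_log[OF a(1-3) y, folded kE_def, folded uE_def, folded k_def, folded u_def]
  have pow: "2 ^ k \<le> Suc (y - x)" "y - x < 2 * 2 ^ k" "(1::nat) \<le> 2 ^ k"
    using floor_log_window[of "y - x"] by (auto simp: k_def)
  have c: "E (Bin Add kE (Cst 2)) = k + 2"
    by (intro ev_add l(1) E_cst) (use l(2) L2_less_w w_pos in linarith)+
  have yB: "y \<le> N div B"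
    using a(4) B_pos by (simp add: less_eq_div_iff_mult_less_eq)
  have win: "E (block_exp e (Bin Add kE (Cst 2))) = rmq X (v * B) ((v + 2 ^ k) * B - 1)"
    and win': "rmq X (v * B) ((v + 2 ^ k) * B - 1) < N"
    if e: "E e = v" and v: "v + 2 ^ k \<le> y + 1" for e v
  proof -
    let ?e = "(v + 2 ^ k) * B - 1"
    have "(v + 1) * B \<le> (v + 2 ^ k) * B" using pow(3) by (intro mult_le_mono) auto
    then have 1: "v * B \<le> ?e" using B_pos by simp
    have "(v + 2 ^ k) * B \<le> (y + 1) * B" using v by (intro mult_le_mono) auto
    then have 2: "?e < N" using a(4) B_pos by simp
    show r: "rmq X (v * B) ?e < N" using rmq_bounds(2)[OF 1, of X] 2 by simp
    have "E (block_exp e (Bin Add kE (Cst 2))) = rmq X (v * B) ?e mod 2 ^ L"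
      using E_block[OF e _ c] v yB pow(3) l(2) by (simp add: block_record_def)
    then show "E (block_exp e (Bin Add kE (Cst 2))) = rmq X (v * B) ?e"
      using r N_le by simp
  qed
  have vx: "x + 2 ^ k \<le> y + 1" using pow a(3) by simp
  have vu: "u + 2 ^ k = y + 1" using pow a(3) by (simp add: u_def)
  have "far_exp a b = shallower_exp (block_exp a (Bin Add kE (Cst 2))) (block_exp uE (Bin Add kE (Cst 2)))"
    by (simp add: far_exp_def Let_def kE_def uE_def)
  also have "E \<dots> = shallower X (rmq X (x * B) ((x + 2 ^ k) * B - 1)) (rmq X (u * B) ((u + 2 ^ k) * B - 1))"
    using vu by (intro E_shallower win[OF a(1) vx] win'[OF a(1) vx] win[OF l(3)] win'[OF l(3)]) auto
  also have "(u + 2 ^ k) * B - 1 = y * B + B - 1" unfolding vu by simp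
  also have "shallower X (rmq X (x * B) ((x + 2 ^ k) * B - 1)) (rmq X (u * B) (y * B + B - 1)) =
      rmq X (x * B) (y * B + B - 1)"
    unfolding u_def
    by (rule rmq_block_windows[symmetric, OF inj_range[OF a(4)] a(3) k_def B_pos])
  finally show ?thesis .
qed

lemma E_rmq:
  assumes a: "E a = x" "E b = y" "x \<le> y" "y < N"
  shows "E (rmq_exp a b) = rmq X x y"
proof -
  define c d where "c = x div B" and "d = y div B"
  define ba bb where "ba = Bin Div a block_size_exp" and "bb = Bin Div b block_size_exp"
  define eE where "eE = Bin Add (Bin Mul ba block_size_exp) (Bin Sub block_size_exp (Cst 1))"
  define dE where "dE = Bin Mul bb block_size_exp"
  have E1: "E ba = c" "E bb = d"
    unfolding ba_def bb_def c_def d_def by (intro ev_div a E_block_size)+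
  have cd: "c \<le> d" unfolding c_def d_def using a(3) by (rule div_le_mono)
  have xb: "c * B \<le> x" "x < c * B + B" and yb: "d * B \<le> y" "y < d * B + B"
    using div_times_less_eq_dividend[of x B] dividend_less_div_times[OF B_pos, of x]
      div_times_less_eq_dividend[of y B] dividend_less_div_times[OF B_pos, of y]
    by (simp_all add: c_def d_def)
  have rE: "rmq_exp a b = Ite (Bin Eq ba bb) (near_exp a b)
         (Ite (Bin Eq (Bin Add ba (Cst 1)) bb) (shallower_exp (near_exp a eE) (near_exp dE b))
           (shallower_exp (shallower_exp (near_exp a eE) (far_exp (Bin Add ba (Cst 1)) (Bin Sub bb (Cst 1))))
             (near_exp dE b)))"
    by (simp add: rmq_exp_def Let_def ba_def bb_def eE_def dE_def)
  show ?thesis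
  proof (cases "c = d")
    case True
    then have "E (near_exp a b) = rmq X x y"
      using xb yb a(3) by (intro E_near a) auto
    then show ?thesis
      unfolding rE using ev_eq[OF E1] True by simp
  next
    case False
    then have cd1: "c + 1 \<le> d" using cd by simp
    then have "(c + 1) * B \<le> d * B" by (rule mult_le_mono1)
    then have e: "c * B + B \<le> d * B" by simp
    define z where "z = c * B + B - 1"
    have z: "x \<le> z" "z < N" "z - x < B" "z + 1 = c * B + B" "z < d * B"
      using xb yb e a(4) B_pos by (auto simp: z_def)
    have "d * 1 \<le> d * B" using B_pos by (intro mult_le_mono) auto
    then have dN: "d < N" using yb a(4) by linarith
    have "E (Bin Sub block_size_exp (Cst 1)) = B - 1"
      using B_pos B_less_w w_pos by (intro ev_sub E_block_size E_cst) auto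
    then have "E eE = c * B + (B - 1)"
      unfolding eE_def using z N_le_w by (intro ev_add ev_mul E1 E_block_size) (auto simp: z_def)
    then have Ee: "E eE = z" using B_pos by (simp add: z_def)
    have Ed: "E dE = d * B"
      unfolding dE_def using yb a(4) N_le_w by (intro ev_mul E1 E_block_size) auto
    have p: "E (near_exp a eE) = rmq X x z" by (intro E_near a Ee z)
    have q: "E (near_exp dE b) = rmq X (d * B) y"
      using yb by (intro E_near a Ed) auto
    have pN: "rmq X x z < N" using rmq_bounds(2)[OF z(1), of X] z(2) by simp
    have qN: "rmq X (d * B) y < N" using rmq_bounds(2)[OF yb(1), of X] a(4) by simp
    have E2: "E (Bin Add ba (Cst 1)) = c + 1"
      using w_pos cd1 dN N_le_w by (intro ev_add E1 E_cst) auto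
    show ?thesis
    proof (cases "c + 1 = d")
      case True
      have "rmq X x y = shallower X (rmq X x z) (rmq X (d * B) y)"
        by (rule rmq_union[OF inj_range[OF a(4)]]) (use z yb xb a(3) True in auto)
      then show ?thesis
        unfolding rE using ev_eq[OF E1] ev_eq[OF E2 E1(2)] False True E_shallower[OF p q pN qN] by simp
    next
      case nTrue: False
      have E3: "E (Bin Sub bb (Cst 1)) = d - 1"
        using w_pos cd1 dN N_le_w by (intro ev_sub E1 E_cst) auto
      define y' where "y' = d * B - 1"
      have d1: "(d - 1) * B + B - 1 = y'" using cd1 by (cases d) (auto simp: y'_def)
      have "c + 2 \<le> d" using cd1 nTrue by simp
      then have "(c + 2) * B \<le> d * B" by (rule mult_le_mono1)
      then have y': "c * B + B \<le> y'" "y' < y" "y' + 1 = d * B" "x \<le> y'"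
        using B_pos yb xb unfolding y'_def by (simp_all add: algebra_simps)
      have "E (far_exp (Bin Add ba (Cst 1)) (Bin Sub bb (Cst 1))) = rmq X ((c + 1) * B) ((d - 1) * B + B - 1)"
        by (intro E_far E2 E3) (use d1 y' a(4) cd1 nTrue in auto)
      then have f: "E (far_exp (Bin Add ba (Cst 1)) (Bin Sub bb (Cst 1))) = rmq X (c * B + B) y'"
        unfolding d1 by (simp add: add.commute)
      have fN: "rmq X (c * B + B) y' < N" using rmq_bounds(2)[OF y'(1), of X] y' a(4) by simp
      have "rmq X x y' = shallower X (rmq X x z) (rmq X (c * B + B) y')"
        by (rule rmq_union[OF inj_range]) (use z y' xb a(4) in auto)
      then have g: "E (shallower_exp (near_exp a eE) (far_exp (Bin Add ba (Cst 1)) (Bin Sub bb (Cst 1)))) = rmq X x y'"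
        using E_shallower[OF p f pN fN] by simp
      have gN: "rmq X x y' < N" using rmq_bounds(2)[OF y'(4), of X] y' a(4) by simp
      have "rmq X x y = shallower X (rmq X x y') (rmq X (d * B) y)"
        by (rule rmq_union[OF inj_range[OF a(4)]]) (use z y' yb xb a(3) in auto)
      then show ?thesis
        unfolding rE using ev_eq[OF E1] ev_eq[OF E2 E1(2)] False nTrue E_shallower[OF g q gN qN] by simp
    qed
  qed
qed

end

section \<open>Queries through runs\<close>

definition layout :: "nat \<Rightarrow> nat \<Rightarrow> nat \<Rightarrow> nat list list \<Rightarrow> nat list" where
  "layout L s mode S =
     [2 ^ s * (2 * L + 1), s, mode]
     @ map (\<lambda>t. 3 + length S + length (concat (take t S))) [0..<length S] @ concat S"

lemma length_layout: "length (layout L s mode S) = 3 + length S + length (concat S)"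
  by (simp add: layout_def)

lemma layout_simps [simp]:
  "layout L s mode S ! 0 = 2 ^ s * (2 * L + 1)"
  "layout L s mode S ! Suc 0 = s"
  "layout L s mode S ! 2 = mode"
  by (simp_all add: layout_def)

lemma stored_layout:
  assumes t: "t < length S"
  shows "stored (layout L s mode S) t (S ! t)"
proof -
  define b where "b = 3 + length S + length (concat (take t S))"
  have split: "concat S = concat (take t S) @ S ! t @ concat (drop (Suc t) S)"
    by (subst id_take_nth_drop[OF t]) simp
  have base: "layout L s mode S ! (3 + t) = b"
    using t by (simp add: layout_def b_def nth_append)
  have "b + k < length (layout L s mode S) \<and> layout L s mode S ! (b + k) = S ! t ! k"
    if k: "k < length (S ! t)" for k
  proof
    show "b + k < length (layout L s mode S)"
      unfolding length_layout split b_def using k by simp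
    have "layout L s mode S ! (b + k) = concat S ! (length (concat (take t S)) + k)"
      by (simp add: layout_def nth_append b_def)
    also have "\<dots> = S ! t ! k"
      unfolding split using k by (simp add: nth_append)
    finally show "layout L s mode S ! (b + k) = S ! t ! k" .
  qed
  then show ?thesis by (simp add: stored_def base)
qed

lemma layout_memory:
  assumes S: "length S = 7" "\<And>x T. T \<in> set S \<Longrightarrow> x \<in> set T \<Longrightarrow> x < 2 ^ L"
    and V: "V = layout L s mode S" "length V < 2 ^ L"
    and L: "L \<le> w" "10 \<le> L" "2 * s + 1 \<le> L" "L < 2 ^ s" "0 < s" "mode < 2"
  shows "indexed_memory w (bits_of_words L V) L s V"
proof -
  have pos: "length (concat (take t S)) \<le> length (concat S)" for t
    by (metis append_take_drop_id concat_append le_add1 length_append)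
  have "2 ^ s * (2 * L + 1) < 2 ^ s * (2 * 2 ^ s)"
    using L(4) by (intro mult_strict_left_mono) auto
  also have "\<dots> = 2 ^ (s + Suc s)"
    by (simp only: power_add power_Suc)
  also have "\<dots> = 2 ^ (2 * s + 1)"
    by (simp add: mult_2)
  also have "\<dots> \<le> 2 ^ L" using L(3) by (rule power_increasing) simp
  finally have h: "2 ^ s * (2 * L + 1) < 2 ^ L" .
  have L2: "L < 2 ^ L" by simp
  have "x < 2 ^ L" if "x \<in> set V" for x
  proof -
    from that consider "x = 2 ^ s * (2 * L + 1)" | "x = s" | "x = mode"
      | t where "x = 3 + length S + length (concat (take t S))" | T where "T \<in> set S" "x \<in> set T"
      by (auto simp: V(1) layout_def)
    then show ?thesis
    proof cases
      case 4
      then show ?thesis using pos[of t] V by (simp add: length_layout)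
    qed (use h L L2 S(2) in auto)
  qed
  then have "word_at L (bits_of_words L V) a = V ! a" if "a < length V" for a
    using that by (intro word_at_bits_of_words) auto
  moreover have "10 \<le> length V" using S(1) by (simp add: V(1) length_layout)
  ultimately show ?thesis
    using L V by unfold_locales auto
qed

lemma rmq_cong:
  assumes "\<And>k. k \<in> {i..j} \<Longrightarrow> X k = Y k" "i \<le> j" "inj_on X {i..j}"
  shows "rmq X i j = rmq Y i j"
proof (rule rmq_eqI[OF assms(3)])
  show m: "rmq Y i j \<in> {i..j}" using rmq_bounds[OF assms(2)] by simp
  show "X (rmq Y i j) \<le> X k" if "k \<in> {i..j}" for k
    using rmq_le[OF that, of Y] assms(1)[OF that] assms(1)[OF m] by simp
qed

lemma psv_le: "psv A x \<le> x"
proof -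
  have "psv A x \<in> insert 0 {k. 1 \<le> k \<and> k < x \<and> A k < A x}"
    unfolding psv_def by (rule Max_in) auto
  then show ?thesis by auto
qed

text \<open>The first segment has an entry past the last run, as finding the run of a position also
  probes the following head. The next two form a two-level rank directory: a full word for every
  \<open>L\<close> blocks of \<open>s * s\<close> positions, and a field per block. Counts inside
  all blocks would take about \<open>n * s\<close> bits; kept per run they take
  \<open>O(s ^ 3)\<close> bits each.\<close>

definition run_segments :: "nat \<Rightarrow> nat \<Rightarrow> nat \<Rightarrow> (nat \<Rightarrow> nat) \<Rightarrow> nat list list" where
  "run_segments L s n A = (let b = s * s in
    [map (\<lambda>u. (if even u then head n A (u div 2) else psv A (head n A (u div 2))) mod 2 ^ L)
       [0..<2 * (runs n A + 1)],
     map (\<lambda>u. run_index A (u * L * b) mod 2 ^ L) [0..<n div b div L + 1],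
     pack L s 1 (n div b + 1) (\<lambda>u _. run_index A (u * b) - run_index A (u div L * L * b)),
     pack L s b (runs n A) (\<lambda>r c. let a = head n A (Suc r) div b * b in run_index A (a + c) - run_index A a)])"

definition head_exp :: "exp \<Rightarrow> exp" where
  "head_exp e = segment_exp 3 (Bin Mul (Cst 2) e)"

definition psv_exp :: "exp \<Rightarrow> exp" where
  "psv_exp e = segment_exp 3 (Bin Add (Bin Mul (Cst 2) e) (Cst 1))"

definition width2_exp :: exp where
  "width2_exp = Bin Mul width_exp width_exp"

definition block_rank_exp :: "exp \<Rightarrow> exp" where
  "block_rank_exp e =
    (let b = Bin Div e width2_exp
     in Bin Add (segment_exp 4 (Bin Div b len_exp)) (field_exp 5 (Cst 1) b (Cst 0)))"

definition rank_exp :: "exp \<Rightarrow> exp" where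
  "rank_exp e =
    (let r = block_rank_exp e
     in Ite (Bin Less e (head_exp (Bin Add r (Cst 1)))) r
         (Bin Add r (field_exp 6 width2_exp r (Bin Mod e width2_exp))))"

definition query_exp :: exp where
  "query_exp =
    (let a = rank_exp ArgI; b = rank_exp ArgJ; m = rmq_exp (Bin Add a (Cst 1)) b
     in Ite mode_exp (rmq_exp ArgI ArgJ)
         (Ite (Bin Eq a b) ArgI
           (Ite (Bin Less (psv_exp m) ArgI) (head_exp m) ArgI)))"

text \<open>The index covers \<open>{..<N}\<close>, hence also position \<open>0\<close>. It
  receives the value \<open>0\<close>, which a permutation of \<open>{1..n}\<close> never takes, and
  lies outside all queries.\<close>

lemma (in rmq_memory) query_dense:
  assumes "V ! 2 = 1" "X = A(0 := 0)" "1 \<le> i" "i \<le> j" "j < N"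
  shows "E query_exp = rmq A i j"
proof -
  have "E query_exp = E (rmq_exp ArgI ArgJ)"
    using E_mode assms(1) by (simp add: query_exp_def Let_def)
  also have "\<dots> = rmq X i j"
    by (rule E_rmq) (use assms in auto)
  also have "\<dots> = rmq A i j"
    by (rule rmq_cong) (use assms inj_range[OF assms(5)] in auto)
  finally show ?thesis .
qed

section \<open>Correctness of queries through runs\<close>

locale run_memory = rmq_memory w D i j L s V "\<lambda>k. A (head n A k)" "runs n A"
  for w D i j L s V n A +
  assumes run_segs: "\<And>t. t < 4 \<Longrightarrow> stored V (3 + t) (run_segments L s n A ! t)"
    and n_pos: "1 \<le> n" and n_less: "n < 2 ^ L"
    and inj_A: "inj_on A {1..n}"
    and cube_le: "s * (s * s) \<le> L"
begin

lemma n_less_w: "n < 2 ^ w" using n_less pow_L_le by linarith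

lemma runs_le: "runs n A \<le> n"
proof -
  have "run_index A n \<le> run_index A 1 + (n - 1)" using n_pos by (rule run_index_diff)
  then show ?thesis using n_pos by (simp add: runs_eq)
qed

lemma main_segment:
  assumes "E e = u" "u < 2 * (runs n A + 1)"
  shows "E (segment_exp 3 e) =
    (if even u then head n A (u div 2) else psv A (head n A (u div 2)))"
proof -
  have S: "stored V 3 (run_segments L s n A ! 0)" using run_segs[of 0] by simp
  have "E (segment_exp 3 e) = run_segments L s n A ! 0 ! u"
    by (rule E_segment[OF S _ assms(1)]) (use assms(2) in \<open>simp_all add: run_segments_def Let_def\<close>)
  also have "\<dots> = (if even u then head n A (u div 2) else psv A (head n A (u div 2))) mod 2 ^ L"
    using assms(2) by (simp add: run_segments_def Let_def del: upt_Suc)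
  also have "\<dots> = (if even u then head n A (u div 2) else psv A (head n A (u div 2)))"
    using psv_le[of A "head n A (u div 2)"] head_bounds(2)[OF n_pos, of A "u div 2"] n_less
    by (intro mod_less) auto
  finally show ?thesis .
qed

text \<open>Indices into a stored segment are below the length of the memory, hence below
  \<open>2 ^ w\<close>.\<close>

lemma main_index_less:
  assumes "k \<le> runs n A"
  shows "2 * k + 1 < 2 ^ w"
proof -
  have S: "stored V 3 (run_segments L s n A ! 0)" using run_segs[of 0] by simp
  show ?thesis
    by (rule stored_index_less(2)[OF S]) (use assms in \<open>simp add: run_segments_def Let_def\<close>)
qed

lemma E_head:
  assumes "E e = k" "k \<le> runs n A"
  shows "E (head_exp e) = head n A k"
proof -
  have "E (Bin Mul (Cst 2) e) = 2 * k"
    by (rule ev_mul[OF E_cst assms(1)]) (use w_pos main_index_less[OF assms(2)] in auto)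
  from main_segment[OF this] show ?thesis
    using assms(2) by (simp add: head_exp_def)
qed

lemma E_psv:
  assumes "E e = k" "k \<le> runs n A"
  shows "E (psv_exp e) = psv A (head n A k)"
proof -
  have "E (Bin Add (Bin Mul (Cst 2) e) (Cst 1)) = 2 * k + 1"
    by (rule ev_add[OF ev_mul[OF E_cst assms(1)] E_cst])
      (use w_pos main_index_less[OF assms(2)] in auto)
  from main_segment[OF this] show ?thesis
    using assms(2) by (simp add: psv_exp_def)
qed

lemma square_le: "s * s \<le> L"
proof -
  have "1 * (s * s) \<le> s * (s * s)" using s_pos by (intro mult_le_mono1) simp
  then show ?thesis using cube_le by linarith
qed

lemma E_width2: "E width2_exp = s * s"
  unfolding width2_exp_def by (intro ev_mul E_width) (use square_le Lw in linarith)

lemma E_block_rank: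
  assumes e: "E e = x" "x \<le> n"
  shows "E (block_rank_exp e) = run_index A (x div (s * s) * (s * s))"
proof -
  define b where "b = s * s"
  define u where "u = x div b"
  have un: "u \<le> n div b" unfolding u_def using e(2) by (rule div_le_mono)
  have Eu: "E (Bin Div e width2_exp) = u"
    unfolding u_def b_def by (intro ev_div e E_width2)
  have ub: "u * b \<le> x" unfolding u_def by simp
  have uL: "u div L * L * b \<le> u * b" by (intro mult_le_mono1) simp
  have less: "run_index A (u div L * L * b) < 2 ^ L"
    using run_index_le[of A "u div L * L * b"] uL ub e(2) n_less by linarith
  have S4: "stored V 4 (run_segments L s n A ! 1)" using run_segs[of 1] by simp
  have "u div L \<le> n div b div L" using un by (rule div_le_mono)
  then have 1: "E (segment_exp 4 (Bin Div (Bin Div e width2_exp) len_exp)) = run_index A (u div L * L * b)"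
    using E_segment[OF S4 _ ev_div[OF Eu E_len]] less
    by (simp add: run_segments_def Let_def b_def del: upt_Suc)
  \<comment> \<open>At most one run starts per position, and fewer than \<open>L\<close> blocks of
    \<open>s * s \<le> L\<close> positions lie in between, so the relative count fits into a
    field.\<close>
  have "run_index A (u * b) - run_index A (u div L * L * b) \<le> u * b - u div L * L * b"
    using run_index_diff[OF uL, of A] by simp
  also have "\<dots> = (u mod L) * b"
    by (simp add: diff_mult_distrib[symmetric] minus_div_mult_eq_mod)
  also have "\<dots> \<le> L * L"
    using L_10 square_le b_def by (intro mult_le_mono) auto
  also have "\<dots> < 2 ^ s" using B_less by (simp add: B_def)
  finally have small: "run_index A (u * b) - run_index A (u div L * L * b) < 2 ^ s" .
  have S5: "stored V 5 (pack L s 1 (n div b + 1)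
      (\<lambda>u _. run_index A (u * b) - run_index A (u div L * L * b)))"
    using run_segs[of 2] by (simp add: run_segments_def Let_def b_def)
  have sL: "s * 1 \<le> L" using s_le by simp
  have 2: "E (field_exp 5 (Cst 1) (Bin Div e width2_exp) (Cst 0)) =
      run_index A (u * b) - run_index A (u div L * L * b)"
    using E_field[OF S5 _ E_cst Eu E_cst _ _ sL] un w_pos small by simp
  have le: "run_index A (u div L * L * b) \<le> run_index A (u * b)"
    using uL by (rule run_index_mono)
  have "E (block_rank_exp e) =
      run_index A (u div L * L * b) + (run_index A (u * b) - run_index A (u div L * L * b))"
    unfolding block_rank_exp_def Let_def
    by (rule ev_add[OF 1 2]) (use le run_index_le[of A "u * b"] ub e(2) n_less_w in linarith)
  then show ?thesis using le by (simp add: u_def b_def)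
qed

lemma E_rank:
  assumes e: "E e = x" "1 \<le> x" "x \<le> n"
  shows "E (rank_exp e) = run_index A x"
proof -
  define b where "b = s * s"
  have b: "0 < b" using s_pos by (simp add: b_def)
  define r where "r = run_index A (x div b * b)"
  define a where "a = head n A (Suc r) div b * b"
  define rE where "rE = block_rank_exp e"
  have Er: "E rE = r" unfolding rE_def r_def b_def by (rule E_block_rank[OF e(1,3)])
  have "r \<le> run_index A n" unfolding r_def using e(3) by (intro run_index_mono) (meson div_times_less_eq_dividend le_trans)
  then have rn: "r < runs n A" by (simp add: runs_eq)
  have "E (Bin Add rE (Cst 1)) = r + 1"
    by (rule ev_add[OF Er E_cst]) (use w_pos rn runs_le n_less_w in linarith)+
  then have Eh: "E (head_exp (Bin Add rE (Cst 1))) = head n A (Suc r)"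
    using E_head[of "Bin Add rE (Cst 1)" "Suc r"] rn by simp
  note by_block = run_index_by_block[OF n_pos b e(2,3) r_def refl]
  have S6: "stored V 6 (pack L s b (runs n A) (\<lambda>r c.
      let a = head n A (Suc r) div b * b in run_index A (a + c) - run_index A a))"
    using run_segs[of 3] by (simp add: run_segments_def Let_def b_def)
  have "run_index A (a + x mod b) - run_index A a \<le> x mod b"
    using run_index_diff[of a "a + x mod b" A] by simp
  also have "\<dots> < b" using b by simp
  also have "b \<le> L * 1" using square_le b_def by simp
  also have "\<dots> < 2 ^ s" using L_less by simp
  finally have small: "run_index A (a + x mod b) - run_index A a < 2 ^ s" .
  have "x mod b < b" using b by simp
  have "E (field_exp 6 width2_exp rE (Bin Mod e width2_exp)) =
      (let a = head n A (Suc r) div b * b in run_index A (a + x mod b) - run_index A a) mod 2 ^ s"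
    by (rule E_field[OF S6 _ E_width2[folded b_def] Er ev_mod[OF e(1) E_width2[folded b_def]] rn \<open>x mod b < b\<close>])
      (use cube_le b_def in auto)
  then have Ef: "E (field_exp 6 width2_exp rE (Bin Mod e width2_exp)) =
      run_index A (a + x mod b) - run_index A a"
    using small by (simp add: a_def Let_def)
  have rk: "rank_exp e = Ite (Bin Less e (head_exp (Bin Add rE (Cst 1)))) rE
         (Bin Add rE (field_exp 6 width2_exp rE (Bin Mod e width2_exp)))"
    by (simp add: rank_exp_def Let_def rE_def)
  show ?thesis
  proof (cases "x < head n A (Suc r)")
    case True
    then show ?thesis
      using ev_less[OF e(1) Eh] Er by_block by (simp add: rk)
  next
    case False
    then have x: "run_index A x = r + (run_index A (a + x mod b) - run_index A a)"
      using by_block by (simp add: a_def)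
    have "E (Bin Add rE (field_exp 6 width2_exp rE (Bin Mod e width2_exp))) = run_index A x"
      unfolding x by (rule ev_add[OF Er Ef])
        (use x run_index_le[of A x] e(3) n_less_w in linarith)
    then show ?thesis
      using ev_less[OF e(1) Eh] False by (simp add: rk)
  qed
qed

lemma query_runs:
  assumes "V ! 2 = 0" and ij: "1 \<le> i" "i \<le> j" "j \<le> n"
  shows "E query_exp = rmq A i j"
proof -
  define a b where "a = rank_exp ArgI" and "b = rank_exp ArgJ"
  define mE where "mE = rmq_exp (Bin Add a (Cst 1)) b"
  have Ea: "E a = run_index A i" "E b = run_index A j"
    unfolding a_def b_def using ij by (auto intro!: E_rank)
  have q: "E query_exp = (if run_index A i = run_index A j then i else
      E (Ite (Bin Less (psv_exp mE) ArgI) (head_exp mE) ArgI))"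
    using E_mode assms(1) ev_eq[OF Ea] by (simp add: query_exp_def Let_def a_def b_def mE_def)
  show ?thesis
  proof (cases "run_index A i = run_index A j")
    case True
    then show ?thesis using q rmq_same_run[OF n_pos inj_A ij True] by simp
  next
    case False
    then have less: "run_index A i < run_index A j"
      using run_index_mono[OF ij(2), of A] by simp
    have jn: "run_index A j < runs n A"
      using run_index_mono[OF ij(3), of A] by (simp add: runs_eq)
    define m where "m = rmq (\<lambda>k. A (head n A k)) (Suc (run_index A i)) (run_index A j)"
    have "E (Bin Add a (Cst 1)) = run_index A i + 1"
      by (rule ev_add[OF Ea(1) E_cst]) (use w_pos less run_index_le[of A j] ij n_less_w in linarith)+
    then have Em: "E mE = m"
      unfolding mE_def m_def using E_rmq[OF _ Ea(2)] less jn by simp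
    have "m \<le> run_index A j" unfolding m_def using less by (intro rmq_bounds) simp
    then have mr: "m \<le> runs n A" using jn by simp
    show ?thesis
      using q False ev_less[of w D i j "psv_exp mE" _ ArgI i "head_exp mE" ArgI, OF E_psv[OF Em mr]]
        E_head[OF Em mr] rmq_different_runs[OF n_pos inj_A ij less m_def] by auto
  qed
qed

end

section \<open>Linear scan for bounded word sizes\<close>

fun scan_pos :: "nat \<Rightarrow> exp" where
  "scan_pos 0 = ArgI"
| "scan_pos (Suc t) = Ite (Bin Less (scan_pos t) ArgJ) (Bin Add (scan_pos t) (Cst 1)) (scan_pos t)"

fun scan_min :: "nat \<Rightarrow> exp" where
  "scan_min 0 = ArgI"
| "scan_min (Suc t) =
     Ite (Bin Less (Prb (scan_pos (Suc t))) (Prb (scan_min t))) (scan_pos (Suc t)) (scan_min t)"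

text \<open>Expressions have no loops, so the scan is unrolled. The position stops at
  \<open>j\<close>, which makes any number of rounds from \<open>j - i\<close> on give the answer.
  The array is stored with a dummy at address 0.\<close>

lemma scan_correct:
  assumes n: "n < 2 ^ w" "1 \<le> w" and A: "bij_betw A {1..n} {1..n}" and ij: "1 \<le> i" "i \<le> j" "j \<le> n"
    and D: "D = bits_of_words w (map (\<lambda>k. if k = 0 then 0 else A k) [0..<n + 1])"
  shows "ev w D i j (scan_pos t) = min (i + t) j"
    and "ev w D i j (scan_min t) = rmq A i (min (i + t) j)"
proof -
  show pos: "ev w D i j (scan_pos t) = min (i + t) j" for t
  proof (induction t)
    case (Suc t)
    have "ev w D i j (Bin Add (scan_pos t) (Cst 1)) = min (i + t) j + 1" if "min (i + t) j < j"
      by (rule ev_add[OF Suc ev_cst]) (use n ij that in auto)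
    moreover have "ev w D i j (scan_pos (Suc t)) = (if min (i + t) j < j
        then ev w D i j (Bin Add (scan_pos t) (Cst 1)) else min (i + t) j)"
      unfolding scan_pos.simps ev_less[OF Suc ev.simps(4)] Suc ..
    ultimately show ?case by auto
  qed (use ij in simp)
  have word: "word_at w D k = A k" if "1 \<le> k" "k \<le> n" for k
  proof -
    have "A x < 2 ^ w" if "x \<in> {1..n}" for x
      using bij_betwE[OF A] that n(1) by fastforce
    then have "word_at w D k = map (\<lambda>k. if k = 0 then 0 else A k) [0..<n + 1] ! k"
      unfolding D using that(2) by (intro word_at_bits_of_words) auto
    then show ?thesis using that by (simp del: upt_Suc)
  qed
  have inj: "inj_on A {i..y}" if "y \<le> n" for y
    using bij_betw_imp_inj_on[OF A] by (rule inj_on_subset) (use ij that in auto)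
  show "ev w D i j (scan_min t) = rmq A i (min (i + t) j)"
  proof (induction t)
    case 0
    have "rmq A i i = i" by (rule rmq_eqI) auto
    then show ?case using ij by simp
  next
    case (Suc t)
    define y where "y = min (i + t) j"
    define y' where "y' = min (i + Suc t) j"
    have y: "i \<le> y" "y \<le> n" "i \<le> y'" "y' \<le> n" using ij by (auto simp: y_def y'_def)
    let ?m = "rmq A i y"
    have m: "i \<le> ?m" "?m \<le> y" using rmq_bounds[OF y(1)] by auto
    have "ev w D i j (scan_min (Suc t)) = (if A y' < A ?m then y' else ?m)"
    proof -
      have "word_at w D y' = A y'" "word_at w D ?m = A ?m"
        using word y m ij by auto
      then show ?thesis
        unfolding scan_min.simps ev_less[OF ev_prb[OF pos[of "Suc t"]] ev_prb[OF Suc]]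
          y_def[symmetric] y'_def[symmetric] Suc[folded y_def] pos[of "Suc t", folded y'_def] by simp
    qed
    also have "\<dots> = rmq A i y'"
    proof (rule rmq_eqI[OF inj[OF y(4)], symmetric])
      show "(if A y' < A ?m then y' else ?m) \<in> {i..y'}" using m y by (auto simp: y_def y'_def)
      fix k assume k: "k \<in> {i..y'}"
      show "A (if A y' < A ?m then y' else ?m) \<le> A k"
      proof (cases "k \<le> y")
        case True
        then have "A ?m \<le> A k" using k by (intro rmq_le) simp
        then show ?thesis by simp
      next
        case False
        then have "k = y'" using k by (auto simp: y_def y'_def)
        then show ?thesis by simp
      qed
    qed
    finally show ?case by (simp add: y'_def)
  qed
qed

text \<open>
  Constants are truncated to the word size, so for \<open>w \<le> c\<close> the constant \<open>2 ^ c\<close> reads as \<open>0\<close>.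
\<close>

definition main_exp :: "nat \<Rightarrow> exp" where
  "main_exp c = (let scan = scan_min (2 ^ 2 ^ c)
     in Ite (Cst (2 ^ c)) (Ite (Bin Less WSize (Cst (2 ^ c))) scan query_exp) scan)"

lemma ev_main:
  "ev w D i j (main_exp c) =
     (if w < 2 ^ c then ev w D i j (scan_min (2 ^ 2 ^ c)) else ev w D i j query_exp)"
proof (cases "c < w")
  case True
  then have "ev w D i j (Cst (2 ^ c)) = 2 ^ c" by (intro ev_cst) simp
  then show ?thesis using ev_less[of w D i j WSize w "Cst (2 ^ c)"] by (simp add: main_exp_def Let_def)
next
  case False
  then have "ev w D i j (Cst (2 ^ c)) = 0"
    by (simp add: ev.simps(1) take_bit_eq_mod mod_eq_0_iff_dvd le_imp_power_dvd)
  moreover have "w < 2 ^ c" using False by (meson less_exp linorder_not_less order_le_less_trans)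
  ultimately show ?thesis by (simp add: main_exp_def Let_def)
qed

section \<open>Space\<close>

text \<open>At least one record fits into a word, so whole records fill more than half of it; this
  is the factor 2. The summand \<open>L\<close> pays for the last word.\<close>

lemma length_pack:
  assumes "0 < s" "0 < m" "s * m \<le> L"
  shows "L * length (pack L s m K f) \<le> 2 * (s * m) * K + L"
proof -
  define q where "q = L div (s * m)"
  have q: "0 < q" using assms by (simp add: q_def div_greater_zero_iff)
  have "L < s * m + q * (s * m)"
    unfolding q_def using assms by (intro dividend_less_div_times) simp
  also have "\<dots> \<le> q * (s * m) + q * (s * m)" using q by simp
  finally have "L \<le> 2 * (s * m) * q" by (simp add: mult_ac)
  then have "L * (K div q) \<le> 2 * (s * m) * q * (K div q)" by (rule mult_le_mono1)
  also have "\<dots> = 2 * (s * m) * (q * (K div q))" by simp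
  also have "\<dots> \<le> 2 * (s * m) * K" by (intro mult_le_mono2) simp
  finally have "L * (K div q) \<le> 2 * (s * m) * K" .
  moreover have "length (pack L s m K f) = K div q + 1"
    by (simp add: pack_def Let_def q_def)
  ultimately show ?thesis by (simp add: algebra_simps)
qed

text \<open>Bits per element of the range minimum index: packed records of \<open>s + 2\<close>
  fields with the packing factor 2, two bits for block records and one for the wide blocks.\<close>

definition dense_rate :: "nat \<Rightarrow> nat" where
  "dense_rate s = 2 * (s * (s + 2)) + 3"

text \<open>Bits per run beyond \<open>2 * (L - 1)\<close>: the counts inside blocks, the index on
  the heads, and the last bit of each of the two words stored for a head.\<close>

definition sparse_rate :: "nat \<Rightarrow> nat" where
  "sparse_rate s = 2 * (s * (s * s)) + dense_rate s + 2"

lemma length_rmq_segments: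
  assumes "0 < s" "s * (s + 2) \<le> L" "2 \<le> L" "L ^ 3 \<le> 2 ^ s"
  shows "L * length (concat (rmq_segments L s X N)) \<le> dense_rate s * N + L * L + 3 * L"
proof -
  define B where "B = L * L"
  define K where "K = N div B"
  have B: "0 < B" using assms(3) by (simp add: B_def)
  have L3: "L ^ 3 = L * B" by (simp add: B_def power3_eq_cube)
  have "1 * B \<le> L * B" using assms(3) by (intro mult_le_mono1) simp
  then have BR: "B \<le> 2 ^ s" using L3 assms(4) by linarith
  have 0: "L * length (pack L s (s + 2) N (small_record X N B)) \<le> 2 * (s * (s + 2)) * N + L"
    using assms by (intro length_pack) auto
  have KB: "K * B \<le> N" by (simp add: K_def)
  have "L * ((K + 1) * (L + 2)) = K * B + 2 * L * K + B + 2 * L"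
    by (simp add: B_def algebra_simps)
  moreover have "2 * L * K \<le> B * K" unfolding B_def using assms(3) by (intro mult_le_mono1) simp
  ultimately have 1: "L * ((K + 1) * (L + 2)) \<le> 2 * N + B + 2 * L"
    using KB unfolding mult.commute[of B K] by linarith
  define W where "W = length (wide_blocks X N B (2 ^ s))"
  \<comment> \<open>An explicit block costs \<open>L ^ 3\<close> bits, at most the descent
    \<open>2 ^ s\<close> that it accounts for.\<close>
  have "L * (W * B) = W * L ^ 3" by (simp add: L3)
  also have "\<dots> \<le> W * 2 ^ s" using assms(4) by (rule mult_le_mono2)
  also have "\<dots> \<le> N" unfolding W_def by (rule length_wide_blocks[OF BR B])
  finally have 2: "L * (W * B) \<le> N" .
  have "L * length (concat (rmq_segments L s X N)) =
      L * length (pack L s (s + 2) N (small_record X N B)) + L * ((K + 1) * (L + 2)) + L * (W * B)"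
    by (simp add: rmq_segments_def Let_def B_def K_def W_def distrib_left del: upt_Suc)
  also have "\<dots> \<le> dense_rate s * N + B + 3 * L"
    using 0 1 2 by (simp add: dense_rate_def distrib_right)
  finally show ?thesis by (simp add: B_def)
qed

lemma length_run_segments:
  assumes "0 < s" "s * (s * s) \<le> L" "0 < L"
  shows "L * length (concat (run_segments L s n A)) \<le>
    2 * runs n A * L + 2 * (s * (s * s)) * runs n A + 3 * (n div s) + 2 * s + 5 * L"
proof -
  define b where "b = s * s"
  have b: "0 < b" using assms(1) by (simp add: b_def)
  have "s * 1 \<le> s * b" using b by (intro mult_le_mono2) simp
  then have s1: "s * 1 \<le> L" using assms(2) unfolding b_def by linarith
  have nb: "s * (n div b) \<le> n div s"
    unfolding b_def by (simp add: div_mult2_eq)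
  have nb': "n div b \<le> n div s"
    unfolding b_def div_mult2_eq by simp
  have 1: "L * (n div b div L + 1) \<le> n div s + L"
    using nb' times_div_less_eq_dividend[of L "n div b"] unfolding distrib_left by linarith
  have "L * length (pack L s 1 (n div b + 1) (\<lambda>u _. run_index A (u * b) - run_index A (u div L * L * b)))
      \<le> 2 * (s * 1) * (n div b + 1) + L"
    using assms s1 by (intro length_pack) auto
  also have "\<dots> \<le> 2 * (n div s) + 2 * s + L" using nb by (simp add: distrib_left)
  finally have 2: "L * length (pack L s 1 (n div b + 1)
      (\<lambda>u _. run_index A (u * b) - run_index A (u div L * L * b))) \<le> 2 * (n div s) + 2 * s + L" .
  have 3: "L * length (pack L s b (runs n A) (\<lambda>r c. let a = head n A (Suc r) div b * b
      in run_index A (a + c) - run_index A a)) \<le> 2 * (s * b) * runs n A + L"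
    using assms b by (intro length_pack) (auto simp: b_def)
  have "L * length (concat (run_segments L s n A)) =
      L * (2 * (runs n A + 1)) + L * (n div b div L + 1)
      + L * length (pack L s 1 (n div b + 1) (\<lambda>u _. run_index A (u * b) - run_index A (u div L * L * b)))
      + L * length (pack L s b (runs n A) (\<lambda>r c. let a = head n A (Suc r) div b * b
          in run_index A (a + c) - run_index A a))"
    by (simp add: run_segments_def Let_def b_def distrib_left del: upt_Suc)
  also have "L * (2 * (runs n A + 1)) = 2 * runs n A * L + 2 * L" by (simp add: algebra_simps)
  finally show ?thesis using 1 2 3 unfolding b_def by linarith
qed

text \<open>The factor 3 is the exponent in \<open>L ^ 3 \<le> 2 ^ s\<close>.\<close>

definition width :: "nat \<Rightarrow> nat" where
  "width L = 3 * (floor_log L + 1)"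

text \<open>The product appears because the index through runs is used only if
  \<open>runs n A * L\<close> is at most \<open>dense_rate s * n\<close>; then its cost beyond the
  leading term is at most \<open>n\<close> for the runs. All size conditions on fields and records
  follow as well.\<close>

definition long_enough :: "nat \<Rightarrow> bool" where
  "long_enough L \<longleftrightarrow> dense_rate (width L) * sparse_rate (width L) \<le> L"

lemma width_properties:
  assumes "long_enough L" "s = width L"
  shows "3 \<le> s" "L ^ 3 \<le> 2 ^ s" "L < 2 ^ s" "s * (s * s) \<le> L" "s * (s + 2) \<le> L"
    "2 * s + 1 \<le> L" "10 \<le> L" "dense_rate s + 5 < L"
proof -
  show s: "3 \<le> s" by (simp add: assms(2) width_def)
  have "L < 2 ^ (floor_log L + 1)" using floor_log_exp2_gt[of L] by simp
  then have "L ^ 3 \<le> (2 ^ (floor_log L + 1)) ^ 3" by (intro power_mono) auto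
  also have "\<dots> = 2 ^ s" unfolding assms(2) width_def by (simp only: power_mult[symmetric] mult.commute)
  finally show L3: "L ^ 3 \<le> 2 ^ s" .
  have dense: "33 \<le> dense_rate s"
    using s mult_le_mono[OF s, of 5 "s + 2"] by (simp add: dense_rate_def)
  have "1 * sparse_rate s \<le> dense_rate s * sparse_rate s"
    using dense by (intro mult_le_mono1) simp
  moreover have prod: "dense_rate s * sparse_rate s \<le> L" using assms by (simp add: long_enough_def)
  ultimately have sp: "sparse_rate s \<le> L" by linarith
  have "33 * sparse_rate s \<le> dense_rate s * sparse_rate s"
    using dense by (intro mult_le_mono1) simp
  then have sp33: "33 * sparse_rate s \<le> L" using prod by linarith
  show "s * (s * s) \<le> L" "s * (s + 2) \<le> L"
    using sp by (simp_all add: sparse_rate_def dense_rate_def)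
  then show "2 * s + 1 \<le> L" using sp33 s by (simp add: sparse_rate_def dense_rate_def)
  show L10: "10 \<le> L" using sp dense by (simp add: sparse_rate_def)
  show "dense_rate s + 5 < L" using sp33 dense by (simp add: sparse_rate_def)
  have "10 * 10 \<le> L * L" using L10 by (intro mult_le_mono)
  then have "L * 1 < L * (L * L)" using L10 by (intro mult_strict_left_mono) auto
  then show "L < 2 ^ s" using L3 unfolding power3_eq_cube by linarith
qed

lemma length_segments [simp]:
  "length (rmq_segments L s X N) = 3" "length (run_segments L s n A) = 4"
  by (simp_all add: rmq_segments_def run_segments_def Let_def)

lemma rmq_segments_words:
  assumes "T \<in> set (rmq_segments L s X N)" "x \<in> set T"
  shows "x < 2 ^ L"
  using assms by (auto simp: rmq_segments_def Let_def intro: pack_less)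

lemma run_segments_words:
  assumes "T \<in> set (run_segments L s n A)" "x \<in> set T"
  shows "x < 2 ^ L"
  using assms by (auto simp: run_segments_def Let_def intro: pack_less)

lemma poly_less_exp: "10 \<le> L \<Longrightarrow> L * L + 19 * L \<le> (2::nat) ^ L"
proof (induction L rule: dec_induct)
  case (step m)
  have "Suc m * Suc m + 19 * Suc m = (m * m + 19 * m) + (2 * m + 20)" by simp
  also have "2 * m + 20 \<le> m * m + 19 * m"
    using step.hyps mult_le_mono[of 10 m 10 m] by simp
  finally show ?case using step.IH by simp
qed simp

text \<open>The bound \<open>L * 2 ^ L\<close> reflects that addresses fit into \<open>L\<close>
  bits; later it also bounds the space by a constant while \<open>L\<close> is constant.\<close>

lemma dense_structure:
  assumes L: "long_enough L" "s = width L" "L \<le> w" and n: "1 \<le> n" "n < 2 ^ L"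
    and A: "bij_betw A {1..n} {1..n}"
  obtains D where "length D < L * 2 ^ L"
    "length D \<le> dense_rate s * n + dense_rate s + L * L + 13 * L"
    "\<And>i j. 1 \<le> i \<Longrightarrow> i \<le> j \<Longrightarrow> j \<le> n \<Longrightarrow> ev w D i j query_exp = rmq A i j"
proof -
  note p = width_properties[OF L(1,2)]
  let ?X = "A(0 := 0)"
  define S where "S = rmq_segments L s ?X (n + 1) @ [[], [], [], []]"
  define V where "V = layout L s 1 S"
  have lenS: "length S = 7" by (simp add: S_def)
  have "L * length V = 10 * L + L * length (concat (rmq_segments L s ?X (n + 1)))"
    by (simp add: V_def length_layout lenS) (simp add: S_def algebra_simps)
  also have "\<dots> \<le> 10 * L + (dense_rate s * (n + 1) + L * L + 3 * L)"
    using p by (intro add_left_mono length_rmq_segments) auto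
  finally have len: "L * length V \<le> dense_rate s * n + dense_rate s + L * L + 13 * L"
    by (simp add: algebra_simps)
  also have "\<dots> \<le> dense_rate s * 2 ^ L + 2 ^ L"
  proof -
    have "dense_rate s * (n + 1) \<le> dense_rate s * 2 ^ L" using n(2) by (intro mult_le_mono2) simp
    then show ?thesis using poly_less_exp[OF p(7)] by simp
  qed
  also have "\<dots> = (dense_rate s + 1) * 2 ^ L" by simp
  also have "\<dots> < L * 2 ^ L" using p(8) by (intro mult_strict_right_mono) auto
  finally have lenV: "length V < 2 ^ L" by simp
  have mem: "indexed_memory w (bits_of_words L V) L s V"
    using lenS _ V_def lenV L(3) p(7,6,3)
  proof (rule layout_memory)
    show "x < 2 ^ L" if "T \<in> set S" "x \<in> set T" for x T
      using that rmq_segments_words by (auto simp: S_def)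
  qed (use p(1) in auto)
  have st: "stored V t (rmq_segments L s ?X (n + 1) ! t)" if "t < 3" for t
  proof -
    have "stored V t (S ! t)" unfolding V_def using that lenS by (intro stored_layout) simp
    then show ?thesis using that by (simp add: S_def nth_append)
  qed
  have injA: "inj_on A {1..n}" using A by (rule bij_betw_imp_inj_on)
  have nz: "A k \<noteq> 0" if "0 < k" "k < n + 1" for k
    using bij_betwE[OF A, rule_format, of k] that by simp
  have eq: "x = y" if "?X x = ?X y" "x \<in> {..<n + 1}" "y \<in> {..<n + 1}" for x y
    using that nz[of x] nz[of y] inj_onD[OF injA, of x y] by (cases "x = 0"; cases "y = 0") auto
  have inj: "inj_on ?X {..<n + 1}" by (rule inj_onI) (rule eq)
  have "rmq_memory w (bits_of_words L V) L s V ?X (n + 1)"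
  proof (rule rmq_memory.intro[OF mem], rule rmq_memory_axioms.intro)
    show "n + 1 \<le> 2 ^ L" using n(2) by linarith
    show "inj_on ?X {..<n + 1}" by (rule inj)
    show "stored V t (rmq_segments L s ?X (n + 1) ! t)" if "t < 3" for t using that by (rule st)
  qed (rule p)+
  then have "ev w (bits_of_words L V) i j query_exp = rmq A i j" if "1 \<le> i" "i \<le> j" "j \<le> n" for i j
    by (rule rmq_memory.query_dense[OF _ _ refl]) (use that in \<open>simp_all add: V_def\<close>)
  moreover have "L * length V < L * 2 ^ L" using lenV p(7) by simp
  ultimately show thesis using len by (intro that[of "bits_of_words L V"]) (auto simp: mult.commute)
qed

lemma sparse_structure:
  assumes L: "long_enough L" "s = width L" "L \<le> w" and n: "1 \<le> n" "n < 2 ^ L"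
    and A: "bij_betw A {1..n} {1..n}"
    and few: "2 * runs n A * (L - 1) < dense_rate s * n"
  obtains D where "length D < L * 2 ^ L"
    "length D \<le> 2 * runs n A * (L - 1) + sparse_rate s * runs n A + 3 * (n div s) + L * L + 19 * L"
    "\<And>i j. 1 \<le> i \<Longrightarrow> i \<le> j \<Longrightarrow> j \<le> n \<Longrightarrow> ev w D i j query_exp = rmq A i j"
proof -
  note p = width_properties[OF L(1,2)]
  let ?X = "\<lambda>k. A (head n A k)"
  define r where "r = runs n A"
  define S where "S = rmq_segments L s ?X r @ run_segments L s n A"
  define V where "V = layout L s 0 S"
  have lenS: "length S = 7" by (simp add: S_def)
  have "L * length V = 10 * L + L * length (concat (rmq_segments L s ?X r)) + L * length (concat (run_segments L s n A))"
    by (simp add: V_def length_layout lenS) (simp add: S_def algebra_simps)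
  also have "\<dots> \<le> 10 * L + (dense_rate s * r + L * L + 3 * L)
      + (2 * r * L + 2 * (s * (s * s)) * r + 3 * (n div s) + 2 * s + 5 * L)"
    unfolding r_def using p by (intro add_mono length_rmq_segments length_run_segments) auto
  also have "\<dots> \<le> 2 * r * (L - 1) + sparse_rate s * r + 3 * (n div s) + L * L + 19 * L"
  proof -
    obtain M where M: "L = Suc M" using p(7) by (cases L) auto
    show ?thesis using p(6) by (simp add: M sparse_rate_def algebra_simps)
  qed
  finally have len: "L * length V \<le> 2 * r * (L - 1) + sparse_rate s * r + 3 * (n div s) + L * L + 19 * L" .
  also have "\<dots> \<le> (dense_rate s + 5) * 2 ^ L"
  proof -
    have "2 * r * (L - 1) \<le> dense_rate s * 2 ^ L"
      using few mult_le_mono2[OF less_imp_le[OF n(2)], of "dense_rate s"] unfolding r_def by linarith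
    moreover have "sparse_rate s * r \<le> 2 ^ L"
    proof -
      \<comment> \<open>This turns \<open>few\<close> into
        \<open>L * r \<le> dense_rate s * n\<close>, at the price of the factor 2 in the leading
        term.\<close>
      have "L \<le> 2 * (L - 1)" using p(7) by simp
      then have "L * r \<le> 2 * (L - 1) * r" by (rule mult_le_mono1)
      also have "\<dots> \<le> dense_rate s * n" using few by (simp add: r_def mult_ac)
      finally have "L * r * sparse_rate s \<le> dense_rate s * n * sparse_rate s" by (rule mult_le_mono1)
      also have "\<dots> = dense_rate s * sparse_rate s * n" by simp
      also have "\<dots> \<le> L * n" using L by (intro mult_le_mono1) (simp add: long_enough_def)
      finally have "L * (sparse_rate s * r) \<le> L * n" by (simp add: mult_ac)
      then have "sparse_rate s * r \<le> n" using p(7) by simp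
      then show ?thesis using n(2) by linarith
    qed
    moreover have "n div s \<le> 2 ^ L" using n(2) by (meson div_le_dividend le_trans less_imp_le)
    ultimately show ?thesis using poly_less_exp[OF p(7)] by (simp add: distrib_right)
  qed
  also have "\<dots> < L * 2 ^ L" using p(8) by (intro mult_strict_right_mono) auto
  finally have lenV: "length V < 2 ^ L" by simp
  have mem: "indexed_memory w (bits_of_words L V) L s V"
    using lenS _ V_def lenV L(3) p(7,6,3)
  proof (rule layout_memory)
    show "x < 2 ^ L" if "T \<in> set S" "x \<in> set T" for x T
      using that rmq_segments_words run_segments_words by (auto simp: S_def)
  qed (use p(1) in auto)
  have st: "stored V t (rmq_segments L s ?X r ! t)" if "t < 3" for t
  proof -
    have "stored V t (S ! t)" unfolding V_def using that lenS by (intro stored_layout) simp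
    then show ?thesis using that by (simp add: S_def nth_append)
  qed
  have st': "stored V (3 + t) (run_segments L s n A ! t)" if "t < 4" for t
  proof -
    have "stored V (3 + t) (S ! (3 + t))" unfolding V_def using that lenS by (intro stored_layout) simp
    then show ?thesis using that by (simp add: S_def nth_append)
  qed
  have injA: "inj_on A {1..n}" using A by (rule bij_betw_imp_inj_on)
  have inj: "inj_on ?X {..<r}"
  proof -
    have "{..<r} = {..run_index A n}" by (auto simp: r_def runs_eq)
    moreover have "inj_on (A \<circ> head n A) {..run_index A n}"
      using inj_on_head[OF n(1)] head_bounds[OF n(1)]
      by (intro comp_inj_on inj_on_subset[OF injA]) auto
    ultimately show ?thesis by (simp add: comp_def)
  qed
  have "run_index A n \<le> n" by (rule run_index_le)
  then have rL: "r \<le> 2 ^ L" using n by (simp add: r_def runs_eq)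
  have "rmq_memory w (bits_of_words L V) L s V ?X r"
    by (rule rmq_memory.intro[OF mem rmq_memory_axioms.intro[OF st inj rL p(2,5)]])
  then have "run_memory w (bits_of_words L V) L s V n A"
    unfolding r_def by (intro run_memory.intro run_memory_axioms.intro st' injA n p(4))
  then have "ev w (bits_of_words L V) i j query_exp = rmq A i j" if "1 \<le> i" "i \<le> j" "j \<le> n" for i j
    by (rule run_memory.query_runs) (use that in \<open>auto simp: V_def\<close>)
  moreover have "L * length V < L * 2 ^ L" using lenV p(7) by simp
  ultimately show thesis
    using len by (intro that[of "bits_of_words L V"]) (auto simp: mult.commute r_def)
qed

section \<open>The lower-order space terms and their asymptotics\<close>

definition overhead :: "nat \<Rightarrow> nat \<Rightarrow> real" where
  "overhead L n =
     real (dense_rate (width L) * sparse_rate (width L)) / real L * real n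
     + 3 / real (width L) * real n + real (dense_rate (width L) + L * L + 19 * L)"

text \<open>The leading term decides: if \<open>2 * r * (L - 1)\<close> reaches
  \<open>dense_rate s * n\<close>, it pays for the index on the whole array. Otherwise
  \<open>r\<close> is at most \<open>dense_rate s * n / L\<close>, and the cost per run contributes
  the first summand of \<open>overhead\<close>.\<close>

lemma index_exists:
  assumes L: "long_enough L" "L \<le> w" and n: "1 \<le> n" "n < 2 ^ L" and A: "bij_betw A {1..n} {1..n}"
  obtains D where "length D < L * 2 ^ L"
    "real (length D) \<le> 2 * real (runs n A) * real (L - 1) + overhead L n"
    "\<And>i j. 1 \<le> i \<Longrightarrow> i \<le> j \<Longrightarrow> j \<le> n \<Longrightarrow> ev w D i j query_exp = rmq A i j"
proof -
  define s where "s = width L"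
  define r where "r = runs n A"
  note p = width_properties[OF L(1) s_def]
  have nonneg: "0 \<le> real (dense_rate s * sparse_rate s) / real L * real n" "0 \<le> 3 / real s * real n"
    by simp_all
  show thesis
  proof (cases "2 * r * (L - 1) < dense_rate s * n")
    case False
    obtain D where D: "length D < L * 2 ^ L"
      "length D \<le> dense_rate s * n + dense_rate s + L * L + 13 * L"
      "\<And>i j. 1 \<le> i \<Longrightarrow> i \<le> j \<Longrightarrow> j \<le> n \<Longrightarrow> ev w D i j query_exp = rmq A i j"
      by (rule dense_structure[OF L(1) s_def L(2) n A]) blast
    have "length D \<le> 2 * r * (L - 1) + (dense_rate s + L * L + 19 * L)"
      using D(2) False by linarith
    then have "real (length D) \<le> real (2 * r * (L - 1) + (dense_rate s + L * L + 19 * L))"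
      by (rule of_nat_mono)
    also have "\<dots> = 2 * real r * real (L - 1) + real (dense_rate s + L * L + 19 * L)"
      by simp
    finally have "real (length D) \<le> 2 * real r * real (L - 1) + overhead L n"
      using nonneg unfolding overhead_def s_def[symmetric] by linarith
    then show thesis using D by (intro that[of D]) (auto simp: r_def)
  next
    case True
    obtain D where D: "length D < L * 2 ^ L"
      "length D \<le> 2 * r * (L - 1) + sparse_rate s * r + 3 * (n div s) + L * L + 19 * L"
      "\<And>i j. 1 \<le> i \<Longrightarrow> i \<le> j \<Longrightarrow> j \<le> n \<Longrightarrow> ev w D i j query_exp = rmq A i j"
      using True unfolding r_def
      by (rule sparse_structure[OF L(1) s_def L(2) n A]) blast
    have "L * r \<le> 2 * (L - 1) * r" using p(7) by (intro mult_le_mono1) simp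
    also have "\<dots> \<le> dense_rate s * n" using True by (simp add: mult_ac)
    finally have "sparse_rate s * (L * r) \<le> sparse_rate s * (dense_rate s * n)" by (rule mult_le_mono2)
    then have "real (sparse_rate s * (L * r)) \<le> real (sparse_rate s * (dense_rate s * n))"
      by (rule of_nat_mono)
    then have 1: "real (sparse_rate s * r) \<le> real (dense_rate s * sparse_rate s) / real L * real n"
      using p(7) by (simp add: field_simps)
    have "real (n div s) \<le> real n / real s" by (rule of_nat_div_le_of_nat)
    then have 2: "real (3 * (n div s)) \<le> 3 / real s * real n" by simp
    have "real (length D) \<le> real (2 * r * (L - 1) + sparse_rate s * r + 3 * (n div s) + L * L + 19 * L)"
      using D(2) by (rule of_nat_mono)
    also have "\<dots> = 2 * real r * real (L - 1) + real (sparse_rate s * r) + real (3 * (n div s)) + real (L * L + 19 * L)"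
      by simp
    also have "\<dots> \<le> 2 * real r * real (L - 1) + overhead L n"
      using 1 2 unfolding overhead_def s_def[symmetric] by simp
    finally show thesis using D by (intro that[of D]) (auto simp: r_def)
  qed
qed

lemma floor_log_le_log: "1 \<le> n \<Longrightarrow> real (floor_log n) \<le> log 2 (real n)"
  by (rule le_log_of_power) (use floor_log_exp2_le[of n] in \<open>simp_all flip: of_nat_power_le_of_nat_cancel_iff\<close>)

text \<open>The rates are at most \<open>9 * s ^ 2\<close> and \<open>13 * s ^ 3\<close>, whence
  117, and \<open>s\<close> is logarithmic in \<open>L\<close>.\<close>

lemma rates_tendsto:
  "(\<lambda>L. real (dense_rate (width L) * sparse_rate (width L)) / real L) \<longlonglongrightarrow> 0"
proof (rule tendsto_sandwich[where f = "\<lambda>_. 0"])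
  show "\<forall>\<^sub>F L in sequentially. real (dense_rate (width L) * sparse_rate (width L)) / real L
      \<le> 117 * (3 * (log 2 (real L) + 1)) ^ 5 / real L"
    using eventually_ge_at_top[of 1]
  proof eventually_elim
    case (elim L)
    define s where "s = width L"
    have s1: "1 \<le> s" by (simp add: s_def width_def)
    have s12: "s * 1 \<le> s * s" using s1 by (intro mult_le_mono2)
    have s23: "s * s * 1 \<le> s * s * s" using s1 by (intro mult_le_mono2)
    have d: "dense_rate s \<le> 9 * (s * s)"
      using s12 s1 unfolding dense_rate_def distrib_left by linarith
    then have "sparse_rate s \<le> 13 * (s * s * s)"
      using s12 s23 s1 unfolding sparse_rate_def mult.assoc by linarith
    with d have "dense_rate s * sparse_rate s \<le> 9 * (s * s) * (13 * (s * s * s))" by (rule mult_le_mono)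
    also have "\<dots> = 117 * (s * s * (s * s * s))" by simp
    also have "s * s * (s * s * s) = s ^ 5" by (simp add: eval_nat_numeral)
    finally have "real (dense_rate s * sparse_rate s) \<le> real (117 * s ^ 5)" by (rule of_nat_mono)
    also have "\<dots> = 117 * real s ^ 5" by simp
    also have "\<dots> \<le> 117 * (3 * (log 2 (real L) + 1)) ^ 5"
      using floor_log_le_log[OF elim] by (intro mult_left_mono power_mono) (auto simp: s_def width_def)
    finally show ?case unfolding s_def by (intro divide_right_mono) auto
  qed
  show "(\<lambda>L. 117 * (3 * (log 2 (real L) + 1)) ^ 5 / real L) \<longlonglongrightarrow> 0"
    by real_asymp
qed auto

text \<open>The threshold is a power of two so that, truncated to \<open>w\<close> bits, it is
  either intact or \<open>0\<close>, which the program can tell apart.\<close>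

lemma eventually_long_enough: "\<exists>c. \<forall>L\<ge>2 ^ c. long_enough L"
proof -
  have "\<forall>\<^sub>F L in sequentially. real (dense_rate (width L) * sparse_rate (width L)) / real L < 1"
    using rates_tendsto by (rule order_tendstoD) simp
  then obtain N where N: "\<And>L. N \<le> L \<Longrightarrow> real (dense_rate (width L) * sparse_rate (width L)) / real L < 1"
    by (auto simp: eventually_at_top_linorder)
  have "long_enough L" if "2 ^ N \<le> L" for L
  proof -
    have "N < 2 ^ N" "(1::nat) \<le> 2 ^ N" by simp_all
    then have L: "N \<le> L" "0 < L" using that by linarith+
    then have "real (dense_rate (width L) * sparse_rate (width L)) < real L"
      using N[of L] by (simp add: divide_simps)
    then have "dense_rate (width L) * sparse_rate (width L) < L" by (simp only: of_nat_less_iff)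
    then show ?thesis by (simp add: long_enough_def)
  qed
  then show ?thesis by blast
qed

lemma filterlim_floor_log: "filterlim floor_log at_top sequentially"
  unfolding filterlim_at_top
proof
  fix Z :: nat
  show "\<forall>\<^sub>F n in sequentially. Z \<le> floor_log n"
    using eventually_ge_at_top[of "2 ^ Z"]
  proof eventually_elim
    case (elim n)
    then show ?case using floor_log_mono[THEN monoD, OF elim] by simp
  qed
qed

lemma overhead_smallo:
  fixes c :: nat and K :: real
  assumes c: "\<forall>L\<ge>2 ^ c. long_enough L"
  defines "len \<equiv> \<lambda>n. max (2 ^ c) (floor_log n + 1)"
  shows "(\<lambda>n. overhead (len n) n + K) \<in> o(\<lambda>n. real n)"
proof (rule smalloI_tendsto)
  have len: "filterlim len at_top sequentially"
    unfolding len_def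
    by (rule filterlim_at_top_mono[OF filterlim_floor_log]) (auto simp: eventually_sequentially)
  have 1: "(\<lambda>n. real (dense_rate (width (len n)) * sparse_rate (width (len n))) / real (len n)) \<longlonglongrightarrow> 0"
    using filterlim_compose[OF rates_tendsto len] .
  have "filterlim width at_top sequentially"
    by (rule filterlim_at_top_mono[OF filterlim_floor_log]) (auto simp: width_def)
  then have "filterlim (\<lambda>n. width (len n)) at_top sequentially"
    using len by (rule filterlim_compose)
  then have "filterlim (\<lambda>n. real (width (len n))) at_top sequentially"
    by (rule filterlim_compose[OF filterlim_real_sequentially])
  then have 2: "(\<lambda>n. 3 / real (width (len n))) \<longlonglongrightarrow> 0"
    by (intro tendsto_divide_0[OF tendsto_const] filterlim_at_top_imp_at_infinity)
  have 3: "(\<lambda>n. (real (dense_rate (width (len n)) + len n * len n + 19 * len n) + \<bar>K\<bar>) / real n) \<longlonglongrightarrow> 0"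
  proof (rule tendsto_sandwich[where f = "\<lambda>_. 0"])
    show "\<forall>\<^sub>F n in sequentially.
        (real (dense_rate (width (len n)) + len n * len n + 19 * len n) + \<bar>K\<bar>) / real n
        \<le> ((log 2 (real n) + 1) ^ 2 + 20 * (log 2 (real n) + 1) + \<bar>K\<bar>) / real n"
      using eventually_ge_at_top[of 1]
        filterlim_floor_log[unfolded filterlim_at_top, rule_format, of "2 ^ c"]
    proof eventually_elim
      case (elim n)
      then have l: "len n = floor_log n + 1" by (simp add: len_def)
      have "long_enough (len n)" using c by (simp add: len_def)
      then have "dense_rate (width (len n)) \<le> len n" using width_properties(8)[OF _ refl] by fastforce
      then have "real (dense_rate (width (len n)) + len n * len n + 19 * len n) \<le>
          real (len n * len n + 20 * len n)" by (intro of_nat_mono) simp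
      also have "\<dots> = real (len n) ^ 2 + 20 * real (len n)" by (simp add: power2_eq_square)
      also have "\<dots> \<le> (log 2 (real n) + 1) ^ 2 + 20 * (log 2 (real n) + 1)"
        using floor_log_le_log[OF elim(1)] by (intro add_mono mult_left_mono power_mono) (auto simp: l)
      finally show ?case by (intro divide_right_mono) auto
    qed
    show "(\<lambda>n. ((log 2 (real n) + 1) ^ 2 + 20 * (log 2 (real n) + 1) + \<bar>K\<bar>) / real n) \<longlonglongrightarrow> 0"
      by real_asymp
  qed auto
  \<comment> \<open>The absolute value made the sandwiched term nonnegative; this is the
    correction.\<close>
  have K: "(\<lambda>n. (K - \<bar>K\<bar>) / real n) \<longlonglongrightarrow> 0"
    by real_asymp
  define f where "f n = real (dense_rate (width (len n)) * sparse_rate (width (len n))) / real (len n)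
      + 3 / real (width (len n))
      + (real (dense_rate (width (len n)) + len n * len n + 19 * len n) + \<bar>K\<bar>) / real n
      + (K - \<bar>K\<bar>) / real n" for n
  have "f \<longlonglongrightarrow> 0 + 0 + 0 + 0"
    unfolding f_def by (intro tendsto_add 1 2 3 K)
  then have "f \<longlonglongrightarrow> 0" by simp
  moreover have "\<forall>\<^sub>F n in sequentially. f n = (overhead (len n) n + K) / real n"
    using eventually_ge_at_top[of 1]
  proof eventually_elim
    case (elim n)
    then have "real n \<noteq> 0" by simp
    then show ?case by (simp add: f_def overhead_def add_divide_distrib diff_divide_distrib)
  qed
  ultimately show "(\<lambda>n. (overhead (len n) n + K) / real n) \<longlonglongrightarrow> 0"
    by (rule Lim_transform_eventually)
  show "\<forall>\<^sub>F n in sequentially. real n \<noteq> 0"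
    using eventually_gt_at_top[of 0] by eventually_elim simp
qed

theorem theorem3:
  "\<exists>(P :: instr list) (T :: nat) (\<epsilon> :: nat \<Rightarrow> real).
     \<epsilon> \<in> o(\<lambda>n. real n) \<and>
     (\<forall>(n :: nat) (w :: nat) (A :: nat \<Rightarrow> nat).
        n \<ge> 1 \<longrightarrow> log 2 (real n) < real w \<longrightarrow> bij_betw A {1..n} {1..n} \<longrightarrow>
        (\<exists>D :: bool list.
           real (length D) \<le> 2 * real (runs n A) * log 2 (real n) + \<epsilon> n \<and>
           (\<forall>i j. 1 \<le> i \<longrightarrow> i \<le> j \<longrightarrow> j \<le> n \<longrightarrow> answers w D P T i j (rmq A i j))))"
proof -
  obtain c where c: "\<forall>L\<ge>2 ^ c. long_enough L" using eventually_long_enough by blast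
  obtain P T where PT: "\<And>w D i j. answers w D P T i j (ev w D i j (main_exp c))"
    using exp_program by metis
  \<comment> \<open>Covers both bounded cases: the stored array of at most \<open>2 ^ w * w\<close>
    bits for \<open>w < 2 ^ c\<close>, and an index of fewer than \<open>L * 2 ^ L\<close> bits for
    \<open>L = 2 ^ c\<close>.\<close>
  define K :: nat where "K = 2 ^ c * 2 ^ 2 ^ c"
  define len where "len n = max (2 ^ c) (floor_log n + 1)" for n
  define \<epsilon> where "\<epsilon> n = overhead (len n) n + real K" for n
  have "\<epsilon> \<in> o(\<lambda>n. real n)"
    using overhead_smallo[OF c, of "real K"] by (simp add: \<epsilon>_def[abs_def] len_def)
  moreover have "\<exists>D. real (length D) \<le> 2 * real (runs n A) * log 2 (real n) + \<epsilon> n \<and>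
      (\<forall>i j. 1 \<le> i \<longrightarrow> i \<le> j \<longrightarrow> j \<le> n \<longrightarrow> answers w D P T i j (rmq A i j))"
    if n: "1 \<le> n" and w: "log 2 (real n) < real w" and A: "bij_betw A {1..n} {1..n}" for n w A
  proof -
    have "real n < 2 powr real w" using w n by (simp add: log_less_iff)
    then have "real n < real (2 ^ w)" by (simp add: powr_realpow)
    then have nw: "n < 2 ^ w" by (simp only: of_nat_less_iff)
    have log: "0 \<le> log 2 (real n)" using n by simp
    have over: "0 \<le> overhead (len n) n" by (simp add: overhead_def)
    have main: "0 \<le> 2 * real (runs n A) * log 2 (real n)" using log by simp
    show ?thesis
    proof (cases "w < 2 ^ c")
      case True
      define D where "D = bits_of_words w (map (\<lambda>k. if k = 0 then 0 else A k) [0..<n + 1])"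
      have w1: "1 \<le> w" using log w by linarith
      have "length D = (n + 1) * w" by (simp add: D_def)
      also have "\<dots> \<le> 2 ^ w * w" using nw by (intro mult_le_mono1) simp
      also have "\<dots> \<le> 2 ^ 2 ^ c * 2 ^ c" using True by (intro mult_le_mono power_increasing) auto
      finally have "length D \<le> K" by (simp add: K_def mult.commute)
      then have "real (length D) \<le> 2 * real (runs n A) * log 2 (real n) + \<epsilon> n"
        using over main by (simp add: \<epsilon>_def)
      moreover have "ev w D i j (main_exp c) = rmq A i j" if ij: "1 \<le> i" "i \<le> j" "j \<le> n" for i j
      proof -
        \<comment> \<open>Hence the \<open>2 ^ 2 ^ c\<close> unrolled rounds reach
          \<open>j\<close>.\<close>
        have "n < 2 ^ 2 ^ c"
          using nw True by (meson less_imp_le order_less_le_trans power_increasing one_le_numeral)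
        then have "min (i + 2 ^ 2 ^ c) j = j" using ij by simp
        then show ?thesis
          using scan_correct(2)[OF nw w1 A ij D_def, of "2 ^ 2 ^ c"] True by (simp add: ev_main)
      qed
      ultimately show ?thesis using PT by metis
    next
      case False
      define L where "L = len n"
      have "real (floor_log n) < real w" using floor_log_le_log[OF n] w by linarith
      then have Lw: "L \<le> w" using False by (simp add: L_def len_def)
      have "n < 2 ^ (floor_log n + 1)" using floor_log_exp2_gt[of n] by simp
      also have "\<dots> \<le> 2 ^ L" by (rule power_increasing) (simp_all add: L_def len_def)
      finally have nL: "n < 2 ^ L" .
      have "long_enough L" using c by (simp add: L_def len_def)
      then obtain D where D: "length D < L * 2 ^ L"
        "real (length D) \<le> 2 * real (runs n A) * real (L - 1) + overhead L n"
        "\<And>i j. 1 \<le> i \<Longrightarrow> i \<le> j \<Longrightarrow> j \<le> n \<Longrightarrow> ev w D i j query_exp = rmq A i j"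
        using index_exists[OF _ Lw n nL A] by metis
      have "real (length D) \<le> 2 * real (runs n A) * log 2 (real n) + \<epsilon> n"
      \<comment> \<open>If \<open>L\<close> was raised to \<open>2 ^ c\<close>, then
        \<open>L - 1\<close> may exceed \<open>log 2 n\<close>, and the constant \<open>K\<close>
        pays; otherwise \<open>L - 1\<close> is the rounded logarithm.\<close>
      proof (cases "L = 2 ^ c")
        case True
        then have "length D \<le> K" using D(1) by (simp add: K_def)
        then show ?thesis using over main by (simp add: \<epsilon>_def)
      next
        case False
        then have "L - 1 = floor_log n" by (auto simp: L_def len_def max_def split: if_splits)
        then have "2 * real (runs n A) * real (L - 1) \<le> 2 * real (runs n A) * log 2 (real n)"
          using floor_log_le_log[OF n] by (intro mult_left_mono) auto
        then show ?thesis using D(2) by (simp add: \<epsilon>_def L_def)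
      qed
      moreover have "ev w D i j (main_exp c) = rmq A i j" if "1 \<le> i" "i \<le> j" "j \<le> n" for i j
        using D(3)[OF that] False by (simp add: ev_main)
      ultimately show ?thesis using PT by metis
    qed
  qed
  ultimately show ?thesis by blast
qed

end
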